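(* For any $X\in{}^{\omega}2$ there exists a partial function $\mathrm{Sel}^X$ from $\omega\times{}^{<\omega}\omega$ to $\omega$, partial feedback computable in $X$, such that for all $e\in\omega$ and $\vec m\in{}^{<\omega}\omega$ the following are equivalent: (i) $\exists p\in\omega\;\;\langle e\rangle^X(p,\vec m)\downarrow$; (ii) $\langle e\rangle^X(\mathrm{Sel}^X(e,\vec m),\vec m)\downarrow$ (in particular $\mathrm{Sel}^X(e,\vec m)$ is defined). Moreover the function $\mathrm{Sel}^X$ is uniformly definable in $X$: there is a single index $s\in\omega$ such that for every $X\in{}^\omega 2$ one may take $\mathrm{Sel}^X(e,\vec m)\simeq\langle s\rangle^X(e,\vec m)$.
   Context: **Feedback computation.** Programs are ordinary oracle Turing machine programs (with oracle $X$), indexed by $e\in\omega$ in a standard way, with an additional instruction allowing the machine at any stage to issue a query $Q^X(e',m')$, with $e',m'$ integers computed by the machine, asking whether the feedback computation $\langle e'\rangle^X(m')$ converges or diverges, and receiving (in one step) an answer in $\{\downarrow,\uparrow\}$. Finite sequences of integers are coded by integers, so an input $m$ may be a tuple. Formally, for a partial function $C$ let $I(C)$ be the set of pairs $\langle\langle e,m,X\rangle,\langle j,k\rangle\rangle$ such that program $e$, run on input $m$ with oracle $X$, makes only queries $Q^X(e',m')$ for which $C(\langle e',m',X\rangle)=\langle j',k'\rangle$ is defined, each such query being answered by $j'$, and either this run halts with output $k\in\omega$ and $j=\,\downarrow$, or it runs forever and $j=\,\uparrow$, $k=\omega$. Let $I_\infty$ be the least fixed point of the monotone operator $I$, obtained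 by iteration from $\emptyset$. Write $\langle e\rangle^X(m)\downarrow k$ iff $I_\infty(\langle e,m,X\rangle)=\langle\downarrow,k\rangle$, and $\langle e\rangle^X(m)\downarrow$ iff this holds for some $k\in\omega$. (The remaining possibilities, value $\langle\uparrow,\omega\rangle$ or $\langle e,m,X\rangle\notin\mathrm{dom}(I_\infty)$, are "divergent" and "freezing" respectively; neither is $\downarrow$.) A partial function $f$ on integers (or tuples) is partial feedback computable in $X$ if for some $e$, $f(m)\simeq\langle e\rangle^X(m)$ for all $m$ (defined exactly when $\langle e\rangle^X(m)\downarrow$, with that value). *)

theory Defs
  imports Complex_Main "HOL-Library.Nat_Bijection"
begin

section \<open>Feedback machines\<close>

text \<open>
  Programs are transition tables of multitape Turing machines over the alphabet {blank, stroke},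
  with the states numbered by the positions in the table.  Tapes are numbered by natural numbers,
  and a program uses only the finitely many tapes that it mentions.  Elements of the Cantor space
  are functions of type \<open>nat \<Rightarrow> bool\<close>.
\<close>

type_synonym cantor = "nat \<Rightarrow> bool"

datatype action = Write bool | Move_Left | Move_Right

text \<open>
  \<open>Act t d\<^sub>0 d\<^sub>1\<close> performs \<open>d\<^sub>1\<close> (an action on tape \<open>t\<close> and a next state) if the scanned cell of
  tape \<open>t\<close> has a stroke, and \<open>d\<^sub>0\<close> otherwise.  \<open>Ask t q\<^sub>0 q\<^sub>1\<close> asks whether the number on tape \<open>t\<close>
  belongs to \<open>X\<close> and goes to \<open>q\<^sub>1\<close> if it does, to \<open>q\<^sub>0\<close> otherwise.
  \<open>Feedback t u q\<^sub>c q\<^sub>d\<close> issues the query \<open>Q\<^sup>X(e', m')\<close> for the numbers \<open>e'\<close>, \<open>m'\<close> on the tapes \<open>t\<close>,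
  \<open>u\<close>, and goes to \<open>q\<^sub>c\<close> on the answer ``converges'' and to \<open>q\<^sub>d\<close> on the answer ``diverges''.
\<close>

datatype instr =
    Act nat "action \<times> nat" "action \<times> nat"
  | Ask nat nat nat
  | Feedback nat nat nat nat

type_synonym program = "instr list"

text \<open>
  A two-way infinite tape: the cells to the left of the head, nearest first, and the cells from
  the scanned one to the right; all cells not listed are blank.
\<close>

type_synonym tape = "bool list \<times> bool list"

fun scanned :: "tape \<Rightarrow> bool" where
  "scanned (ls, []) = False"
| "scanned (ls, r # rs) = r"

fun perform :: "action \<Rightarrow> tape \<Rightarrow> tape" where
  "perform (Write b) (ls, rs) = (ls, b # tl rs)"
| "perform Move_Left ([], rs) = ([], False # rs)"
| "perform Move_Left (l # ls, rs) = (ls, l # rs)"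
| "perform Move_Right (ls, []) = (False # ls, [])"
| "perform Move_Right (ls, r # rs) = (r # ls, rs)"

text \<open>The number on a tape is the total number of strokes on it.\<close>

definition tape_value :: "tape \<Rightarrow> nat" where
  "tape_value T = length (filter id (fst T @ snd T))"

type_synonym config = "nat \<times> (nat \<Rightarrow> tape)"

definition initial :: "nat \<Rightarrow> config" where
  "initial m = (0, (\<lambda>_. ([], []))(0 := ([], replicate m True)))"

definition halted :: "program \<Rightarrow> config \<Rightarrow> bool" where
  "halted P c \<longleftrightarrow> length P \<le> fst c"

definition result :: "config \<Rightarrow> nat" where
  "result c = tape_value (snd c 0)"

text \<open>
  \<open>Converges k\<close> is the value \<open>\<langle>\<down>, k\<rangle>\<close>, and \<open>Diverges\<close> is the value \<open>\<langle>\<up>, \<omega>\<rangle>\<close>.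
\<close>

datatype outcome = Converges nat | Diverges

type_synonym computation = "nat \<times> nat \<times> cantor"

text \<open>
  The partial function \<open>C\<close> that answers the feedback queries is given by its graph.  A query
  outside its domain leaves the machine stuck in a configuration that is not halted.
\<close>

inductive step :: "(computation \<times> outcome) set \<Rightarrow> program \<Rightarrow> cantor \<Rightarrow> config \<Rightarrow> config \<Rightarrow> bool"
  for C :: "(computation \<times> outcome) set" and P :: program and X :: cantor where
  act:
    "q < length P \<Longrightarrow> P ! q = Act t d0 d1 \<Longrightarrow> (a, q') = (if scanned (T t) then d1 else d0)
     \<Longrightarrow> step C P X (q, T) (q', T(t := perform a (T t)))"
| ask:
    "q < length P \<Longrightarrow> P ! q = Ask t q0 q1 \<Longrightarrow> q' = (if X (tape_value (T t)) then q1 else q0)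
     \<Longrightarrow> step C P X (q, T) (q', T)"
| feedback_conv:
    "q < length P \<Longrightarrow> P ! q = Feedback t u qc qd
     \<Longrightarrow> ((tape_value (T t), tape_value (T u), X), Converges k) \<in> C
     \<Longrightarrow> step C P X (q, T) (qc, T)"
| feedback_div:
    "q < length P \<Longrightarrow> P ! q = Feedback t u qc qd
     \<Longrightarrow> ((tape_value (T t), tape_value (T u), X), Diverges) \<in> C
     \<Longrightarrow> step C P X (q, T) (qd, T)"

definition halts_with ::
  "(computation \<times> outcome) set \<Rightarrow> program \<Rightarrow> cantor \<Rightarrow> nat \<Rightarrow> nat \<Rightarrow> bool" where
  "halts_with C P X m k \<longleftrightarrow>
     (\<exists>c. (step C P X)\<^sup>*\<^sup>* (initial m) c \<and> halted P c \<and> result c = k)"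

definition runs_forever ::
  "(computation \<times> outcome) set \<Rightarrow> program \<Rightarrow> cantor \<Rightarrow> nat \<Rightarrow> bool" where
  "runs_forever C P X m \<longleftrightarrow>
     (\<exists>c :: nat \<Rightarrow> config. c 0 = initial m \<and> (\<forall>i. step C P X (c i) (c (Suc i))))"


section \<open>Indexing of the programs\<close>

definition action_decode :: "nat \<Rightarrow> action \<times> nat" where
  "action_decode n =
     ([Write False, Write True, Move_Left, Move_Right] ! (n mod 4), n div 4)"

definition instr_decode :: "nat \<Rightarrow> instr" where
  "instr_decode n =
     (let (t, n1) = prod_decode (n div 3); (a, b) = prod_decode n1 in
        if n mod 3 = 0 then Act t (action_decode a) (action_decode b)
        else if n mod 3 = 1 then Ask t a b
        else let (c, d) = prod_decode b in Feedback t a c d)"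

definition program_of :: "nat \<Rightarrow> program" where
  "program_of e = map instr_decode (list_decode e)"

lemma surj_action_decode: "surj action_decode"
proof -
  have "\<exists>n. action_decode n = (a, q)" for a q
  proof -
    have "\<exists>i<4. [Write False, Write True, Move_Left, Move_Right] ! i = a"
    proof (cases a)
      case (Write b)
      show ?thesis
        by (rule exI[of _ "if b then 1 else 0"]) (simp add: Write)
    next
      case Move_Left
      show ?thesis
        by (rule exI[of _ 2]) (simp add: Move_Left)
    next
      case Move_Right
      show ?thesis
        by (rule exI[of _ 3]) (simp add: Move_Right)
    qed
    then obtain i where "i < 4" "[Write False, Write True, Move_Left, Move_Right] ! i = a"
      by blast
    then have "action_decode (4 * q + i) = (a, q)"
      by (simp add: action_decode_def)
    then show ?thesis ..
  qed
  then show ?thesis by (metis surj_def surj_pair)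
qed

lemma surj_instr_decode: "surj instr_decode"
proof -
  have "\<exists>n. instr_decode n = i" for i
  proof (cases i)
    case (Act t d0 d1)
    obtain a b where ab: "action_decode a = d0" "action_decode b = d1"
      using surj_action_decode by (metis surjD)
    have "instr_decode (3 * prod_encode (t, prod_encode (a, b))) = i"
      by (simp add: instr_decode_def Act ab)
    then show ?thesis ..
  next
    case (Ask t q0 q1)
    have "instr_decode (Suc (3 * prod_encode (t, prod_encode (q0, q1)))) = i"
      by (simp add: instr_decode_def Ask Suc_times_mod_eq div_Suc)
    then show ?thesis ..
  next
    case (Feedback t u qc qd)
    define n where "n = prod_encode (t, prod_encode (u, prod_encode (qc, qd)))"
    have "(3 * n + 2) div 3 = n" "(3 * n + 2) mod 3 = 2" by presburger+
    then have "instr_decode (3 * n + 2) = i"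
      unfolding instr_decode_def by (simp add: Feedback n_def)
    then show ?thesis ..
  qed
  then show ?thesis by (metis surj_def)
qed

lemma surj_program_of: "surj program_of"
proof -
  have "\<exists>e. program_of e = P" for P
  proof -
    have "map instr_decode (map (inv instr_decode) P) = P"
      by (simp add: surj_iff[THEN iffD1, OF surj_instr_decode])
    then have "program_of (list_encode (map (inv instr_decode) P)) = P"
      by (simp add: program_of_def)
    then show ?thesis ..
  qed
  then show ?thesis by (metis surj_def)
qed


section \<open>Feedback computation\<close>

definition feedback_op :: "(computation \<times> outcome) set \<Rightarrow> (computation \<times> outcome) set" where
  "feedback_op C =
     {((e, m, X), Converges k) | e m X k. halts_with C (program_of e) X m k} \<union>
     {((e, m, X), Diverges) | e m X. runs_forever C (program_of e) X m}"

definition feedback :: "(computation \<times> outcome) set" where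
  "feedback = lfp feedback_op"

definition feedback_conv :: "nat \<Rightarrow> cantor \<Rightarrow> nat \<Rightarrow> nat \<Rightarrow> bool" where
  "feedback_conv e X m k \<longleftrightarrow> ((e, m, X), Converges k) \<in> feedback"

definition feedback_defined :: "nat \<Rightarrow> cantor \<Rightarrow> nat \<Rightarrow> bool" where
  "feedback_defined e X m \<longleftrightarrow> (\<exists>k. feedback_conv e X m k)"

text \<open>
  In the next two definitions, \<open>code\<close> gives the integers that represent the arguments of \<open>f\<close> as
  inputs of machines.
\<close>

definition feedback_computes :: "nat \<Rightarrow> cantor \<Rightarrow> ('a \<Rightarrow> nat) \<Rightarrow> ('a \<rightharpoonup> nat) \<Rightarrow> bool" where
  "feedback_computes e X code f \<longleftrightarrow> (\<forall>x k. f x = Some k \<longleftrightarrow> feedback_conv e X (code x) k)"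

definition partial_feedback_computable :: "cantor \<Rightarrow> ('a \<Rightarrow> nat) \<Rightarrow> ('a \<rightharpoonup> nat) \<Rightarrow> bool" where
  "partial_feedback_computable X code f \<longleftrightarrow> (\<exists>e. feedback_computes e X code f)"

text \<open>The input \<open>(p, m\<^sub>1, \<dots>, m\<^sub>n)\<close> is the code of this sequence of length \<open>n + 1\<close>.\<close>

definition tuple_code :: "nat \<times> nat list \<Rightarrow> nat" where
  "tuple_code = (\<lambda>(p, ms). list_encode (p # ms))"


section \<open>The fixed point is a partial function\<close>

lemma step_mono: "step C P X c c' \<Longrightarrow> C \<subseteq> D \<Longrightarrow> step D P X c c'"
  by (induction rule: step.induct) (auto intro: step.intros)

lemma mono_feedback_op: "mono feedback_op"
proof (rule monoI)
  fix C D :: "(computation \<times> outcome) set"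
  assume "C \<subseteq> D"
  then have le: "step C P X \<le> step D P X" for P X
    by (auto intro: step_mono)
  have "halts_with C P X m k \<Longrightarrow> halts_with D P X m k" for P X m k
    unfolding halts_with_def using rtranclp_mono[OF le] by blast
  moreover have "runs_forever C P X m \<Longrightarrow> runs_forever D P X m" for P X m
    unfolding runs_forever_def using le by blast
  ultimately show "feedback_op C \<subseteq> feedback_op D"
    unfolding feedback_op_def by (intro Un_mono) auto
qed

lemma feedback_unfold: "feedback = feedback_op feedback"
  unfolding feedback_def by (rule lfp_unfold[OF mono_feedback_op])

lemma not_step_halted: "halted P c \<Longrightarrow> \<not> step C P X c c'"
  by (auto simp: halted_def elim: step.cases)

lemma step_compatible:
  assumes "step C P X c c1" "step D P X c c2"
    and compat: "\<forall>x r s. (x, r) \<in> C \<longrightarrow> (x, s) \<in> D \<longrightarrow> r = s"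
  shows "c1 = c2"
  using assms(1)
proof cases
  case (act q t d0 d1 a q' T)
  show ?thesis
    using assms(2) unfolding act(1)
    by (cases rule: step.cases) (use act in \<open>auto split: if_splits\<close>)
next
  case (ask q t q0 q1 q' T)
  show ?thesis
    using assms(2) unfolding ask(1)
    by (cases rule: step.cases) (use ask in auto)
next
  case (feedback_conv q t u qc qd T k)
  have "((tape_value (T t), tape_value (T u), X), Diverges) \<notin> D"
    using compat feedback_conv by blast
  with assms(2) show ?thesis unfolding feedback_conv(1)
    by (cases rule: step.cases) (use feedback_conv in auto)
next
  case (feedback_div q t u qc qd T)
  have "((tape_value (T t), tape_value (T u), X), Converges k) \<notin> D" for k
    using compat feedback_div by blast
  with assms(2) show ?thesis unfolding feedback_div(1)
    by (cases rule: step.cases) (use feedback_div in auto)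
qed

lemma halting_runs_compatible:
  assumes "(step C P X)\<^sup>*\<^sup>* c c1" "halted P c1" "(step D P X)\<^sup>*\<^sup>* c c2" "halted P c2"
    and compat: "\<forall>x r s. (x, r) \<in> C \<longrightarrow> (x, s) \<in> D \<longrightarrow> r = s"
  shows "c1 = c2"
  using assms(1,3)
proof (induction rule: converse_rtranclp_induct)
  case base
  then show ?case
    using not_step_halted[OF assms(2)] by (metis converse_rtranclpE)
next
  case (step c c')
  then have "c \<noteq> c2"
    using not_step_halted[OF assms(4)] by blast
  then obtain c'' where c'': "step D P X c c''" "(step D P X)\<^sup>*\<^sup>* c'' c2"
    using step.prems by (metis converse_rtranclpE)
  then have "c' = c''"
    using step_compatible[OF step.hyps(1) c''(1) compat] by blast
  then show ?case
    using step.IH c''(2) by blast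
qed

lemma halting_run_not_forever:
  assumes "(step C P X)\<^sup>*\<^sup>* c c1" "halted P c1" "f 0 = c" "\<And>i. step D P X (f i) (f (Suc i))"
    and compat: "\<forall>x r s. (x, r) \<in> C \<longrightarrow> (x, s) \<in> D \<longrightarrow> r = s"
  shows False
  using assms(1,3,4)
proof (induction arbitrary: f rule: converse_rtranclp_induct)
  case base
  then show ?case
    using not_step_halted[OF assms(2)] by metis
next
  case (step c c')
  have "step D P X c (f (Suc 0))"
    using step.prems by metis
  then have "c' = f (Suc 0)"
    using step_compatible[OF step.hyps(1) _ compat] by blast
  then show ?case
    using step.IH[of "\<lambda>i. f (Suc i)"] step.prems(2) by simp
qed

lemma feedback_op_compatible:
  assumes compat: "\<forall>x r s. (x, r) \<in> C \<longrightarrow> (x, s) \<in> D \<longrightarrow> r = s"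
    and "(x, r) \<in> feedback_op C" "(x, s) \<in> feedback_op D"
  shows "r = s"
proof -
  obtain e m X where x: "x = (e, m, X)" by (cases x)
  have compat': "\<forall>x r s. (x, r) \<in> D \<longrightarrow> (x, s) \<in> C \<longrightarrow> r = s"
    using compat by metis
  show ?thesis
  proof (cases r; cases s)
    fix k l assume [simp]: "r = Converges k" "s = Converges l"
    obtain c1 c2 where runs: "(step C (program_of e) X)\<^sup>*\<^sup>* (initial m) c1" "halted (program_of e) c1"
        "(step D (program_of e) X)\<^sup>*\<^sup>* (initial m) c2" "halted (program_of e) c2"
        and out: "result c1 = k" "result c2 = l"
      using assms(2,3) x by (auto simp: feedback_op_def halts_with_def)
    have "c1 = c2"
      by (rule halting_runs_compatible[OF runs compat])
    then show "r = s" using out by simp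
  next
    fix k assume [simp]: "r = Converges k" "s = Diverges"
    obtain c1 f where "(step C (program_of e) X)\<^sup>*\<^sup>* (initial m) c1" "halted (program_of e) c1"
        "f 0 = initial m" "\<And>i. step D (program_of e) X (f i) (f (Suc i))"
      using assms(2,3) x by (auto simp: feedback_op_def halts_with_def runs_forever_def)
    then have False
      by (rule halting_run_not_forever[OF _ _ _ _ compat])
    then show "r = s" ..
  next
    fix k assume [simp]: "s = Converges k" "r = Diverges"
    obtain c1 f where "(step D (program_of e) X)\<^sup>*\<^sup>* (initial m) c1" "halted (program_of e) c1"
        "f 0 = initial m" "\<And>i. step C (program_of e) X (f i) (f (Suc i))"
      using assms(2,3) x by (auto simp: feedback_op_def halts_with_def runs_forever_def)
    then have False
      by (rule halting_run_not_forever[OF _ _ _ _ compat'])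
    then show "r = s" ..
  qed simp
qed

lemma single_valued_feedback: "single_valued feedback"
proof -
  have "\<forall>x r s. (x, r) \<in> feedback \<longrightarrow> (x, s) \<in> feedback \<longrightarrow> r = s"
    unfolding feedback_def
  proof (rule lfp_ordinal_induct[OF mono_feedback_op,
        where P = "\<lambda>C. \<forall>x r s. (x, r) \<in> C \<longrightarrow> (x, s) \<in> lfp feedback_op \<longrightarrow> r = s"])
    fix C
    assume IH: "\<forall>x r s. (x, r) \<in> C \<longrightarrow> (x, s) \<in> lfp feedback_op \<longrightarrow> r = s"
    have "r = s" if "(x, r) \<in> feedback_op C" "(x, s) \<in> lfp feedback_op" for x r s
    proof (rule feedback_op_compatible)
      show "(x, s) \<in> feedback_op (lfp feedback_op)"
        using that(2) lfp_unfold[OF mono_feedback_op] by simp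
    qed (use IH that in auto)
    then show "\<forall>x r s. (x, r) \<in> feedback_op C \<longrightarrow> (x, s) \<in> lfp feedback_op \<longrightarrow> r = s"
      by blast
  qed blast
  then show ?thesis
    unfolding single_valued_def by blast
qed

lemma feedback_conv_unique: "feedback_conv e X m k \<Longrightarrow> feedback_conv e X m l \<Longrightarrow> k = l"
  unfolding feedback_conv_def using single_valued_feedback by (auto dest: single_valuedD)

end

theory Submission
  imports Defs
begin

text \<open>
  Call a computation settled if it does not freeze.  The comparison of computations \<open>x\<close> and \<open>y\<close>
  (``does \<open>x\<close> have greater rank than \<open>y\<close>?'') is a single feedback program: it simulates \<open>x\<close>, and
  before each query \<open>x'\<close> it asks for the comparison of \<open>y\<close> with \<open>x'\<close>.  If that diverges, it halts;
  otherwise \<open>x'\<close> is settled and it is safe to issue the query.  If the simulated run ends, it loops.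
  Hence, if one of \<open>x\<close>, \<open>y\<close> is settled, so is the comparison, and its outcome names a settled one
  of the two.

  The selection follows Gandy.  Let \<open>B n\<close> be a computation that is settled iff \<open>\<langle>e\<rangle>(n, m)\<close> converges, and let \<open>Y n\<close> compare
  \<open>B n\<close> with \<open>Y (n + 1)\<close>: if \<open>B n\<close> is found settled, it outputs \<open>n\<close>, otherwise it queries \<open>Y (n + 1)\<close>
  and continues as \<open>Y (n + 1)\<close>.  If \<open>B p\<close> is settled, then so are \<open>Y p\<close>, \<open>Y (p - 1)\<close>, ..., \<open>Y 0\<close>.
  Conversely, the query of \<open>Y (n + 1)\<close> makes the search well-founded, so a settled \<open>Y n\<close> outputs
  some \<open>k\<close> with \<open>\<langle>e\<rangle>(k, m)\<close> convergent.  Thus \<open>Y 0\<close> selects.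

  These programs are primitive recursive transition functions, run by a Turing machine that works
  with unary counters.  They receive their own index as part of the input.
\<close>

section \<open>Counter programs\<close>

type_synonym store = "nat \<Rightarrow> nat"

text \<open>Register \<open>r\<close> is tape \<open>r\<close>. \<open>Query\<close> and
  \<open>Member\<close> report their answer by adding 1 to register \<open>r\<close> or leaving it
  unchanged.\<close>

datatype cmd =
    Inc nat
  | Dec nat
  | Seq cmd cmd  (infixr ";;" 60)
  | While nat cmd
  | Cond nat cmd cmd
  | Query nat nat nat
  | Member nat nat

fun cmd_length :: "cmd \<Rightarrow> nat" where
  "cmd_length (Inc r) = 2"
| "cmd_length (Dec r) = 2"
| "cmd_length (c ;; d) = cmd_length c + cmd_length d"
| "cmd_length (While r c) = cmd_length c + 2"
| "cmd_length (Cond r c d) = cmd_length c + cmd_length d + 2"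
| "cmd_length (Query t u r) = 3"
| "cmd_length (Member t r) = 3"

text \<open>An \<open>Act\<close> always performs some action, so a pure branch rewrites the symbol
  it has just scanned.\<close>

definition branch :: "nat \<Rightarrow> nat \<Rightarrow> nat \<Rightarrow> instr" where
  "branch r q0 q1 = Act r (Write False, q0) (Write True, q1)"

text \<open>A counter grows at its left end: the cell to the left of the head is blank, so one move
  and one stroke lengthen the block.\<close>

definition inc_code :: "nat \<Rightarrow> nat \<Rightarrow> program" where
  "inc_code p r =
     [Act r (Move_Left, Suc p) (Move_Left, Suc p), Act r (Write True, p + 2) (Write True, p + 2)]"

text \<open>Jump targets are absolute, hence the address \<open>p\<close>. Control leaves every
  block at \<open>p + cmd_length c\<close>. A \<open>branch\<close> with two equal targets is a
  plain jump.\<close>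

fun compile :: "nat \<Rightarrow> cmd \<Rightarrow> program" where
  "compile p (Inc r) = inc_code p r"
| "compile p (Dec r) =
     [Act r (Write False, p + 2) (Write False, Suc p), Act r (Move_Right, p + 2) (Move_Right, p + 2)]"
| "compile p (c ;; d) = compile p c @ compile (p + cmd_length c) d"
| "compile p (While r c) =
     branch r (p + cmd_length c + 2) (Suc p) # compile (Suc p) c @ [branch r p p]"
| "compile p (Cond r c d) =
     branch r (p + cmd_length c + 2) (Suc p) # compile (Suc p) c @
     branch r (p + cmd_length c + cmd_length d + 2) (p + cmd_length c + cmd_length d + 2) #
     compile (p + cmd_length c + 2) d"
| "compile p (Query t u r) = Feedback t u (Suc p) (p + 3) # inc_code (Suc p) r"
| "compile p (Member t r) = Ask t (p + 3) (Suc p) # inc_code (Suc p) r"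

lemma length_compile [simp]: "length (compile p c) = cmd_length c"
  by (induction p c rule: compile.induct) (auto simp: inc_code_def)

section \<open>Big-step semantics of counter programs\<close>

inductive exec :: "(computation \<times> outcome) set \<Rightarrow> cantor \<Rightarrow> cmd \<Rightarrow> store \<Rightarrow> store \<Rightarrow> bool"
  for C :: "(computation \<times> outcome) set" and X :: cantor where
  Inc: "exec C X (Inc r) \<sigma> (\<sigma>(r := Suc (\<sigma> r)))"
| Dec: "exec C X (Dec r) \<sigma> (\<sigma>(r := \<sigma> r - 1))"
| Seq: "exec C X c \<sigma> \<sigma>' \<Longrightarrow> exec C X d \<sigma>' \<sigma>'' \<Longrightarrow> exec C X (c ;; d) \<sigma> \<sigma>''"
| While_end: "\<sigma> r = 0 \<Longrightarrow> exec C X (While r c) \<sigma> \<sigma>"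
| While_step: "\<sigma> r \<noteq> 0 \<Longrightarrow> exec C X c \<sigma> \<sigma>' \<Longrightarrow> exec C X (While r c) \<sigma>' \<sigma>''
    \<Longrightarrow> exec C X (While r c) \<sigma> \<sigma>''"
| Cond_true: "\<sigma> r \<noteq> 0 \<Longrightarrow> exec C X c \<sigma> \<sigma>' \<Longrightarrow> exec C X (Cond r c d) \<sigma> \<sigma>'"
| Cond_false: "\<sigma> r = 0 \<Longrightarrow> exec C X d \<sigma> \<sigma>' \<Longrightarrow> exec C X (Cond r c d) \<sigma> \<sigma>'"
| Query_conv: "((\<sigma> t, \<sigma> u, X), Converges k) \<in> C
    \<Longrightarrow> exec C X (Query t u r) \<sigma> (\<sigma>(r := Suc (\<sigma> r)))"
| Query_div: "((\<sigma> t, \<sigma> u, X), Diverges) \<in> C \<Longrightarrow> exec C X (Query t u r) \<sigma> \<sigma>"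
| Member: "exec C X (Member t r) \<sigma> (\<sigma>(r := \<sigma> r + of_bool (X (\<sigma> t))))"

text \<open>The counterpart of \<open>exec\<close> for runs that get stuck at a query outside the
  domain of \<open>C\<close>. Infinite runs are treated separately, loop round by loop round, with
  \<open>while_round_steps\<close>.\<close>

inductive blocked :: "(computation \<times> outcome) set \<Rightarrow> cantor \<Rightarrow> cmd \<Rightarrow> store \<Rightarrow> bool"
  for C :: "(computation \<times> outcome) set" and X :: cantor where
  Query: "\<forall>v. ((\<sigma> t, \<sigma> u, X), v) \<notin> C \<Longrightarrow> blocked C X (Query t u r) \<sigma>"
| Seq1: "blocked C X c \<sigma> \<Longrightarrow> blocked C X (c ;; d) \<sigma>"
| Seq2: "exec C X c \<sigma> \<sigma>' \<Longrightarrow> blocked C X d \<sigma>' \<Longrightarrow> blocked C X (c ;; d) \<sigma>"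
| While: "\<sigma> r \<noteq> 0 \<Longrightarrow> blocked C X c \<sigma> \<Longrightarrow> blocked C X (While r c) \<sigma>"
| While_step: "\<sigma> r \<noteq> 0 \<Longrightarrow> exec C X c \<sigma> \<sigma>' \<Longrightarrow> blocked C X (While r c) \<sigma>'
    \<Longrightarrow> blocked C X (While r c) \<sigma>"
| Cond_true: "\<sigma> r \<noteq> 0 \<Longrightarrow> blocked C X c \<sigma> \<Longrightarrow> blocked C X (Cond r c d) \<sigma>"
| Cond_false: "\<sigma> r = 0 \<Longrightarrow> blocked C X d \<sigma> \<Longrightarrow> blocked C X (Cond r c d) \<sigma>"

fun code_at :: "program \<Rightarrow> nat \<Rightarrow> program \<Rightarrow> bool" where
  "code_at P p [] \<longleftrightarrow> True"
| "code_at P p (i # is) \<longleftrightarrow> p < length P \<and> P ! p = i \<and> code_at P (Suc p) is"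

lemma code_at_append [simp]:
  "code_at P p (is @ js) \<longleftrightarrow> code_at P p is \<and> code_at P (p + length is) js"
  by (induction "is" arbitrary: p) auto

lemma code_at_drop: "code_at (P @ is @ Q) (length P) is"
proof (induction "is" arbitrary: P)
  case (Cons i "is")
  show ?case using Cons[of "P @ [i]"] by (simp add: nth_append)
qed simp

lemma code_at_self: "code_at P 0 P"
  using code_at_drop[of "[]" P "[]"] by simp

text \<open>The block of strokes starts under the head, so the scanned cell decides whether the
  value is 0. Listed blanks are allowed on both sides because moves and erasures leave them
  behind.\<close>

definition counter :: "tape \<Rightarrow> nat \<Rightarrow> bool" where
  "counter T n \<longleftrightarrow> True \<notin> set (fst T) \<and> (\<exists>j. snd T = replicate n True @ replicate j False)"

definition counters :: "(nat \<Rightarrow> tape) \<Rightarrow> store \<Rightarrow> bool" where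
  "counters T \<sigma> \<longleftrightarrow> (\<forall>t. counter (T t) (\<sigma> t))"

lemma filter_id_no_strokes: "True \<notin> set xs \<Longrightarrow> filter id xs = []"
  by (induction xs) auto

lemma tape_value_counter: "counter T n \<Longrightarrow> tape_value T = n"
  by (auto simp: counter_def tape_value_def filter_id_no_strokes)

lemma counters_value: "counters T \<sigma> \<Longrightarrow> tape_value (T t) = \<sigma> t"
  by (simp add: counters_def tape_value_counter)

lemma scanned_counter: "counter T n \<Longrightarrow> scanned T \<longleftrightarrow> n \<noteq> 0"
  by (cases T; cases n) (auto simp: counter_def elim!: scanned.elims dest: sym
      simp: Cons_eq_append_conv Cons_replicate_eq)

lemma counter_inc:
  "counter T n \<Longrightarrow> counter (perform (Write True) (perform Move_Left T)) (Suc n)"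
  by (cases "(Move_Left, T)" rule: perform.cases) (auto simp: counter_def)

lemma counter_dec:
  assumes "counter T n" "n \<noteq> 0"
  shows "counter (perform Move_Right (perform (Write False) T)) (n - 1)"
  using assms by (cases T; cases n) (auto simp: counter_def)

lemma counter_zero:
  assumes "counter T 0"
  shows "counter (perform (Write False) T) 0"
proof -
  obtain ls j where "T = (ls, replicate j False)" "True \<notin> set ls"
    using assms by (cases T) (auto simp: counter_def)
  then show ?thesis
    by (cases j) (auto simp: counter_def intro: exI[of _ "Suc _"])
qed

lemma counter_rewrite:
  assumes "counter T n" "n \<noteq> 0"
  shows "counter (perform (Write True) T) n"
  using assms by (cases T; cases n) (auto simp: counter_def)

lemma step_Act:
  assumes "q < length P" "P ! q = Act t d0 d1"
    and "d = (if scanned (T t) then d1 else d0)"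
  shows "step C P X (q, T) (snd d, T(t := perform (fst d) (T t)))"
  using step.act[OF assms(1,2), where T = T and a = "fst d" and q' = "snd d"] assms(3) by simp

lemma branch_step:
  assumes "q < length P" "P ! q = branch r q0 q1" "counters T \<sigma>"
  shows "\<exists>T'. counters T' \<sigma> \<and> step C P X (q, T) (if \<sigma> r = 0 then q0 else q1, T')"
proof -
  have r: "counter (T r) (\<sigma> r)"
    using assms(3) by (simp add: counters_def)
  show ?thesis
  proof (cases "\<sigma> r = 0")
    case True
    with r have "counters (T(r := perform (Write False) (T r))) \<sigma>"
      using assms(3) counter_zero[of "T r"] by (auto simp: counters_def)
    moreover have "step C P X (q, T) (q0, T(r := perform (Write False) (T r)))"
      using step_Act[OF assms(1) assms(2)[unfolded branch_def] refl, where T = T]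
      by (simp add: scanned_counter[OF r] True)
    ultimately show ?thesis using True by auto
  next
    case False
    with r have "counters (T(r := perform (Write True) (T r))) \<sigma>"
      using assms(3) counter_rewrite[of "T r"] by (auto simp: counters_def)
    moreover have "step C P X (q, T) (q1, T(r := perform (Write True) (T r)))"
      using step_Act[OF assms(1) assms(2)[unfolded branch_def] refl, where T = T]
      by (simp add: scanned_counter[OF r] False)
    ultimately show ?thesis using False by auto
  qed
qed

lemma inc_code_steps:
  assumes "code_at P p (inc_code p r)" "counters T \<sigma>"
  shows "\<exists>T'. counters T' (\<sigma>(r := Suc (\<sigma> r))) \<and> (step C P X)\<^sup>*\<^sup>* (p, T) (p + 2, T')"
proof -
  have r: "counter (T r) (\<sigma> r)"
    using assms(2) by (simp add: counters_def)
  let ?T1 = "T(r := perform Move_Left (T r))"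
  let ?T2 = "?T1(r := perform (Write True) (?T1 r))"
  have "step C P X (p, T) (Suc p, ?T1)"
    using step_Act[OF _ _ refl, of p P r "(Move_Left, Suc p)" "(Move_Left, Suc p)" C X T] assms(1)
    by (simp add: inc_code_def)
  moreover have "step C P X (Suc p, ?T1) (p + 2, ?T2)"
    using step_Act[OF _ _ refl, of "Suc p" P r "(Write True, p + 2)" "(Write True, p + 2)" C X ?T1]
      assms(1)
    by (simp add: inc_code_def)
  moreover have "counters ?T2 (\<sigma>(r := Suc (\<sigma> r)))"
    using assms(2) counter_inc[OF r] by (auto simp: counters_def)
  ultimately show ?thesis by (meson converse_rtranclp_into_rtranclp rtranclp.rtrancl_refl)
qed

lemma step_inc_code_steps:
  assumes "step C P X (p, T) (Suc p, T)" "code_at P (Suc p) (inc_code (Suc p) r)" "counters T \<sigma>"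
  shows "\<exists>T'. counters T' (\<sigma>(r := Suc (\<sigma> r))) \<and> (step C P X)\<^sup>*\<^sup>* (p, T) (p + 3, T')"
proof -
  have "Suc p + 2 = p + 3" by simp
  with inc_code_steps[OF assms(2,3)] obtain T' where
    "counters T' (\<sigma>(r := Suc (\<sigma> r)))" "(step C P X)\<^sup>*\<^sup>* (Suc p, T) (p + 3, T')"
    by metis
  with assms(1) show ?thesis by (meson converse_rtranclp_into_rtranclp)
qed

text \<open>Each block is entered at its first instruction and left just behind its last one, so
  runs of blocks compose. The final tapes are given only up to the counter values, since the listed
  blanks depend on the history.\<close>

lemma exec_steps:
  assumes "exec C X c \<sigma> \<sigma>'" "code_at P p (compile p c)" "counters T \<sigma>"
  shows "\<exists>T'. counters T' \<sigma>' \<and> (step C P X)\<^sup>*\<^sup>* (p, T) (p + cmd_length c, T')"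
  using assms
proof (induction arbitrary: p T rule: exec.induct)
  case (Inc r \<sigma>)
  then show ?case
    unfolding compile.simps cmd_length.simps by (rule inc_code_steps)
next
  case (Dec r \<sigma>)
  have r: "counter (T r) (\<sigma> r)"
    using Dec(2) by (simp add: counters_def)
  let ?T1 = "T(r := perform (Write False) (T r))"
  let ?T2 = "?T1(r := perform Move_Right (?T1 r))"
  have 1: "step C P X (p, T) (if \<sigma> r = 0 then p + 2 else Suc p, ?T1)"
    using step_Act[OF _ _ refl, of p P r "(Write False, p + 2)" "(Write False, Suc p)" C X T] Dec(1)
    by (simp add: scanned_counter[OF r] split: if_splits)
  have "\<exists>T'. counters T' (\<sigma>(r := \<sigma> r - 1)) \<and>
      (step C P X)\<^sup>*\<^sup>* (p, T) (p + cmd_length (Dec r), T')"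
  proof (cases "\<sigma> r = 0")
    case True
    then have "counters ?T1 (\<sigma>(r := \<sigma> r - 1))"
      using Dec(2) r counter_zero[of "T r"] by (auto simp: counters_def)
    then show ?thesis using 1 True by (auto intro!: exI[of _ ?T1])
  next
    case False
    have "step C P X (Suc p, ?T1) (p + 2, ?T2)"
      using step_Act[OF _ _ refl, of "Suc p" P r "(Move_Right, p + 2)" "(Move_Right, p + 2)" C X ?T1]
        Dec(1) by simp
    moreover have "counters ?T2 (\<sigma>(r := \<sigma> r - 1))"
      using Dec(2) counter_dec[OF r False] by (auto simp: counters_def)
    ultimately show ?thesis
      using 1 False by (intro exI[of _ ?T2]) (auto intro: converse_rtranclp_into_rtranclp)
  qed
  then show ?case .
next
  case (Seq c \<sigma> \<sigma>' d \<sigma>'')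
  obtain T1 where T1: "counters T1 \<sigma>'" "(step C P X)\<^sup>*\<^sup>* (p, T) (p + cmd_length c, T1)"
    using Seq.IH(1)[of p T] Seq.prems by auto
  obtain T2 where "counters T2 \<sigma>''"
    "(step C P X)\<^sup>*\<^sup>* (p + cmd_length c, T1) (p + cmd_length c + cmd_length d, T2)"
    using Seq.IH(2)[of "p + cmd_length c" T1] Seq.prems(1) T1(1) by auto
  with T1 show ?case
    unfolding cmd_length.simps add.assoc by (meson rtranclp_trans)
next
  case (While_end \<sigma> r c)
  then show ?case
    using branch_step[of p P r "p + cmd_length c + 2" "Suc p" T \<sigma> C X] by auto
next
  case (While_step \<sigma> r c \<sigma>' \<sigma>'')
  then obtain T1 where T1: "counters T1 \<sigma>" "step C P X (p, T) (Suc p, T1)"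
    using branch_step[of p P r "p + cmd_length c + 2" "Suc p" T \<sigma> C X] by auto
  moreover obtain T2 where T2: "counters T2 \<sigma>'"
    "(step C P X)\<^sup>*\<^sup>* (Suc p, T1) (Suc p + cmd_length c, T2)"
    using While_step.IH(1)[of "Suc p" T1] While_step.prems(1) T1(1) by auto
  \<comment> \<open>Both targets of the closing branch are \<open>p\<close>, so it returns to the
    loop head whatever register \<open>r\<close> holds.\<close>
  moreover from T2(1) While_step obtain T3 where T3: "counters T3 \<sigma>'"
    "step C P X (Suc p + cmd_length c, T2) (p, T3)"
    using branch_step[of "Suc p + cmd_length c" P r p p T2 \<sigma>' C X] by (auto split: if_splits)
  moreover obtain T4 where "counters T4 \<sigma>''"
    "(step C P X)\<^sup>*\<^sup>* (p, T3) (p + cmd_length (While r c), T4)"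
    using While_step.IH(2)[OF While_step.prems(1) T3(1)] by blast
  ultimately show ?case
    by (meson converse_rtranclp_into_rtranclp rtranclp_trans)
next
  case (Cond_true \<sigma> r c \<sigma>' d)
  then obtain T1 where T1: "counters T1 \<sigma>" "step C P X (p, T) (Suc p, T1)"
    using branch_step[of p P r "p + cmd_length c + 2" "Suc p" T \<sigma> C X] by auto
  moreover obtain T2 where T2: "counters T2 \<sigma>'"
    "(step C P X)\<^sup>*\<^sup>* (Suc p, T1) (Suc p + cmd_length c, T2)"
    using Cond_true.IH[of "Suc p" T1] Cond_true.prems(1) T1(1) by auto
  moreover from T2(1) Cond_true obtain T3 where T3: "counters T3 \<sigma>'"
    "step C P X (Suc p + cmd_length c, T2) (p + cmd_length (Cond r c d), T3)"
    using branch_step[of "Suc p + cmd_length c" P r "p + cmd_length (Cond r c d)"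
        "p + cmd_length (Cond r c d)" T2 \<sigma>' C X]
    by (auto simp: add.assoc split: if_splits)
  ultimately show ?case
    by (meson converse_rtranclp_into_rtranclp rtranclp.rtrancl_into_rtrancl)
next
  case (Cond_false \<sigma> r d \<sigma>' c)
  then obtain T1 where T1: "counters T1 \<sigma>" "step C P X (p, T) (p + cmd_length c + 2, T1)"
    using branch_step[of p P r "p + cmd_length c + 2" "Suc p" T \<sigma> C X] by auto
  moreover obtain T2 where T2: "counters T2 \<sigma>'"
    "(step C P X)\<^sup>*\<^sup>* (p + cmd_length c + 2, T1) (p + cmd_length c + 2 + cmd_length d, T2)"
    using Cond_false.IH[of "p + cmd_length c + 2" T1] Cond_false.prems(1) T1(1) by auto
  moreover have "p + cmd_length c + 2 + cmd_length d = p + cmd_length (Cond r c d)"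
    by simp
  ultimately show ?case
    by (metis converse_rtranclp_into_rtranclp)
next
  case (Query_conv \<sigma> t u k r)
  then have "step C P X (p, T) (Suc p, T)"
    using step.feedback_conv[of p P t u "Suc p" "p + 3" T X k C]
    by (simp add: counters_value)
  with Query_conv show ?case
    unfolding cmd_length.simps by (intro step_inc_code_steps) auto
next
  case (Query_div \<sigma> t u r)
  then have "step C P X (p, T) (p + 3, T)"
    using step.feedback_div[of p P t u "Suc p" "p + 3" T X C]
    by (simp add: counters_value)
  then show ?case using Query_div by auto
next
  case (Member t r \<sigma>)
  then have 1: "step C P X (p, T) (if X (\<sigma> t) then Suc p else p + 3, T)"
    using step.ask[of p P t "p + 3" "Suc p" _ X T C]
    by (simp add: counters_value)
  have "\<exists>T'. counters T' (\<sigma>(r := \<sigma> r + of_bool (X (\<sigma> t)))) \<and>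
      (step C P X)\<^sup>*\<^sup>* (p, T) (p + cmd_length (Member t r), T')"
  proof (cases "X (\<sigma> t)")
    case True
    then show ?thesis
      using step_inc_code_steps[of C P X p T r \<sigma>] Member 1 by simp
  next
    case False
    then show ?thesis using Member 1 by auto
  qed
  then show ?case .
qed

text \<open>The completed commands in front of the stuck query are crossed with
  \<open>exec_steps\<close>; at the query itself no rule of \<open>step\<close> applies.\<close>

lemma blocked_steps:
  assumes "blocked C X c \<sigma>" "code_at P p (compile p c)" "counters T \<sigma>"
  shows "\<exists>c'. (step C P X)\<^sup>*\<^sup>* (p, T) c' \<and> \<not> halted P c' \<and> (\<forall>c''. \<not> step C P X c' c'')"
  using assms
proof (induction arbitrary: p T rule: blocked.induct)
  case (Query \<sigma> t u r)
  then have "\<not> step C P X (p, T) c''" for c''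
    by (auto elim!: step.cases simp: counters_value)
  with Query show ?case
    by (intro exI[of _ "(p, T)"]) (auto simp: halted_def)
next
  case (Seq1 c \<sigma> d)
  then show ?case by simp
next
  case (Seq2 c \<sigma> \<sigma>' d)
  then obtain T1 where T1: "counters T1 \<sigma>'" "(step C P X)\<^sup>*\<^sup>* (p, T) (p + cmd_length c, T1)"
    using exec_steps[OF Seq2.hyps(1), of P p T] by auto
  with Seq2.IH[of "p + cmd_length c" T1] Seq2.prems show ?case
    by (auto intro: rtranclp_trans)
next
  case (While \<sigma> r c)
  then obtain T1 where T1: "counters T1 \<sigma>" "step C P X (p, T) (Suc p, T1)"
    using branch_step[of p P r "p + cmd_length c + 2" "Suc p" T \<sigma> C X] by auto
  with While.IH[of "Suc p" T1] While.prems show ?case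
    by (auto intro: converse_rtranclp_into_rtranclp)
next
  case (While_step \<sigma> r c \<sigma>')
  then obtain T1 where T1: "counters T1 \<sigma>" "step C P X (p, T) (Suc p, T1)"
    using branch_step[of p P r "p + cmd_length c + 2" "Suc p" T \<sigma> C X] by auto
  moreover from T1(1) While_step obtain T2 where T2: "counters T2 \<sigma>'"
    "(step C P X)\<^sup>*\<^sup>* (Suc p, T1) (Suc p + cmd_length c, T2)"
    using exec_steps[OF While_step.hyps(2), of P "Suc p" T1] by auto
  moreover from T2(1) While_step obtain T3 where T3: "counters T3 \<sigma>'"
    "step C P X (Suc p + cmd_length c, T2) (p, T3)"
    using branch_step[of "Suc p + cmd_length c" P r p p T2 \<sigma>' C X] by (auto split: if_splits)
  ultimately have "(step C P X)\<^sup>*\<^sup>* (p, T) (p, T3)"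
    by (meson converse_rtranclp_into_rtranclp rtranclp.rtrancl_into_rtrancl)
  with While_step.IH[OF While_step.prems(1) T3(1)] show ?case
    by (meson rtranclp_trans)
next
  case (Cond_true \<sigma> r c d)
  then obtain T1 where T1: "counters T1 \<sigma>" "step C P X (p, T) (Suc p, T1)"
    using branch_step[of p P r "p + cmd_length c + 2" "Suc p" T \<sigma> C X] by auto
  with Cond_true.IH[of "Suc p" T1] Cond_true.prems show ?case
    by (auto intro: converse_rtranclp_into_rtranclp)
next
  case (Cond_false \<sigma> r d c)
  then obtain T1 where T1: "counters T1 \<sigma>" "step C P X (p, T) (p + cmd_length c + 2, T1)"
    using branch_step[of p P r "p + cmd_length c + 2" "Suc p" T \<sigma> C X] by auto
  with Cond_false.IH[of "p + cmd_length c + 2" T1] Cond_false.prems show ?case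
    by (auto intro: converse_rtranclp_into_rtranclp)
qed

text \<open>A round takes at least one step. This strictness makes infinitely many rounds an
  infinite run.\<close>

lemma while_round_steps:
  assumes "\<sigma> r \<noteq> 0" "exec C X c \<sigma> \<sigma>'" "code_at P p (compile p (While r c))" "counters T \<sigma>"
  shows "\<exists>T'. counters T' \<sigma>' \<and> (step C P X)\<^sup>+\<^sup>+ (p, T) (p, T')"
proof -
  obtain T1 where T1: "counters T1 \<sigma>" "step C P X (p, T) (Suc p, T1)"
    using branch_step[of p P r "p + cmd_length c + 2" "Suc p" T \<sigma> C X] assms by auto
  moreover from T1(1) obtain T2 where T2: "counters T2 \<sigma>'"
    "(step C P X)\<^sup>*\<^sup>* (Suc p, T1) (Suc p + cmd_length c, T2)"
    using exec_steps[OF assms(2), of P "Suc p" T1] assms(3) by auto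
  moreover from T2(1) obtain T3 where T3: "counters T3 \<sigma>'"
    "step C P X (Suc p + cmd_length c, T2) (p, T3)"
    using branch_step[of "Suc p + cmd_length c" P r p p T2 \<sigma>' C X] assms(3)
    by (auto split: if_splits)
  ultimately show ?thesis
    by (meson rtranclp.rtrancl_into_rtrancl rtranclp_into_tranclp2)
qed

section \<open>Register arithmetic: moving, pairing, unpairing\<close>

lemma exec_cong: "exec C X c \<sigma> \<tau> \<Longrightarrow> \<tau> = \<tau>' \<Longrightarrow> exec C X c \<sigma> \<tau>'"
  by simp

text \<open>\<open>I i\<close> is the store after \<open>i\<close> rounds and \<open>n\<close> the
  number of rounds.\<close>

lemma exec_While:
  assumes "\<And>i. i < n \<Longrightarrow> I i r \<noteq> 0" "\<And>i. i < n \<Longrightarrow> exec C X c (I i) (I (Suc i))"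
    and "I n r = 0" "I 0 = \<sigma>" "I n = \<tau>"
  shows "exec C X (While r c) \<sigma> \<tau>"
proof -
  have "i \<le> n \<Longrightarrow> exec C X (While r c) (I i) (I n)" for i
  proof (induction "n - i" arbitrary: i)
    case 0
    then show ?case using assms(3) by (auto intro: exec.While_end)
  next
    case (Suc d)
    then have "i < n" by simp
    moreover have "exec C X (While r c) (I (Suc i)) (I n)"
      using Suc by simp
    ultimately show ?case
      using assms(1,2) by (metis exec.While_step)
  qed
  then show ?thesis using assms(4,5) by auto
qed

definition clear :: "nat \<Rightarrow> cmd" where
  "clear r = While r (Dec r)"

definition move :: "nat \<Rightarrow> nat \<Rightarrow> cmd" where
  "move r s = While r (Dec r ;; Inc s)"

definition move2 :: "nat \<Rightarrow> nat \<Rightarrow> nat \<Rightarrow> cmd" where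
  "move2 r s t = While r (Dec r ;; Inc s ;; Inc t)"

text \<open>This follows \<open>prod_encode (a, b) = triangle (a + b) + a\<close>: register
  \<open>k\<close> starts with \<open>a\<close>, and the loop adds \<open>a + b\<close>,
  \<open>a + b - 1\<close>, ..., 1 to it.\<close>

definition pair_cmd :: "nat \<Rightarrow> cmd" where
  "pair_cmd k = move2 (k + 1) k (k + 3) ;; move (k + 3) (k + 2) ;;
     While (k + 2) (move2 (k + 2) k (k + 1) ;; move (k + 1) (k + 2) ;; Dec (k + 2))"

text \<open>The input is counted down while registers \<open>k + 1\<close> and \<open>k + 2\<close>
  walk through the diagonal enumeration of pairs from \<open>(0, 0)\<close>, as in
  \<open>prod_decode_Suc\<close>.\<close>

definition unpair_cmd :: "nat \<Rightarrow> cmd" where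
  "unpair_cmd k = While k (Dec k ;;
     Cond (k + 2) (Dec (k + 2) ;; Inc (k + 1)) (move (k + 1) (k + 2) ;; Inc (k + 2)))"

lemma exec_clear: "exec C X (clear r) \<sigma> (\<sigma>(r := 0))"
  unfolding clear_def
  by (rule exec_While[where n = "\<sigma> r" and I = "\<lambda>i. \<sigma>(r := \<sigma> r - i)"])
    (auto intro!: exec_cong[OF exec.Dec])

lemma exec_move:
  assumes "r \<noteq> s"
  shows "exec C X (move r s) \<sigma> (\<sigma>(r := 0, s := \<sigma> s + \<sigma> r))"
  unfolding move_def
  by (rule exec_While[where n = "\<sigma> r" and I = "\<lambda>i. \<sigma>(r := \<sigma> r - i, s := \<sigma> s + i)"])
    (use assms in \<open>auto intro!: exec_cong[OF exec.Seq[OF exec.Dec exec.Inc]]\<close>)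

lemma exec_move2:
  assumes "r \<noteq> s" "r \<noteq> t" "s \<noteq> t"
  shows "exec C X (move2 r s t) \<sigma> (\<sigma>(r := 0, s := \<sigma> s + \<sigma> r, t := \<sigma> t + \<sigma> r))"
  unfolding move2_def
  by (rule exec_While[where n = "\<sigma> r"
        and I = "\<lambda>i. \<sigma>(r := \<sigma> r - i, s := \<sigma> s + i, t := \<sigma> t + i)"])
    (use assms in \<open>auto intro!: exec_cong[OF exec.Seq[OF exec.Dec exec.Seq[OF exec.Inc exec.Inc]]]\<close>)

lemma triangle_eq_sum: "triangle n = (\<Sum>j<n. n - j)"
proof (induction n)
  case (Suc n)
  then show ?case by (subst sum.lessThan_Suc_shift) simp
qed simp

lemma exec_pair_cmd:
  assumes "\<sigma> k = 0" "\<sigma> (k + 3) = 0"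
  shows "exec C X (pair_cmd k) \<sigma>
    (\<sigma>(k := prod_encode (\<sigma> (k + 1), \<sigma> (k + 2)), k + 1 := 0, k + 2 := 0))"
proof -
  define a b where ab: "a = \<sigma> (k + 1)" "b = \<sigma> (k + 2)"
  define I where "I i = \<sigma>(k := a + (\<Sum>j<i. a + b - j), k + 1 := 0, k + 2 := a + b - i)" for i
  have body: "exec C X (move2 (k + 2) k (k + 1) ;; move (k + 1) (k + 2) ;; Dec (k + 2)) (I i) (I (Suc i))" for i
    by (rule exec_cong[OF exec.Seq[OF exec_move2 exec.Seq[OF exec_move exec.Dec]]])
      (auto simp: I_def fun_eq_iff)
  have 3: "exec C X (While (k + 2) (move2 (k + 2) k (k + 1) ;; move (k + 1) (k + 2) ;; Dec (k + 2)))
    (\<sigma>(k := a, k + 1 := 0, k + 2 := a + b))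
    (\<sigma>(k := prod_encode (a, b), k + 1 := 0, k + 2 := 0))"
    by (rule exec_While[where I = I and n = "a + b", OF _ body])
      (auto simp: I_def prod_encode_def triangle_eq_sum fun_eq_iff)
  have 2: "exec C X (move (k + 3) (k + 2)) (\<sigma>(k := a, k + 1 := 0, k + 3 := a))
      (\<sigma>(k := a, k + 1 := 0, k + 2 := a + b))"
    by (rule exec_cong[OF exec_move]) (use assms ab in \<open>auto simp: fun_eq_iff\<close>)
  have 1: "exec C X (move2 (k + 1) k (k + 3)) \<sigma> (\<sigma>(k := a, k + 1 := 0, k + 3 := a))"
    by (rule exec_cong[OF exec_move2]) (use assms ab in \<open>auto simp: fun_eq_iff\<close>)
  show ?thesis
    unfolding pair_cmd_def ab[symmetric] by (rule exec.Seq[OF 1 exec.Seq[OF 2 3]])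
qed

text \<open>The enumeration moves along a diagonal of constant \<open>a + b\<close>, and from its
  end, where \<open>b = 0\<close>, to the start of the next one.\<close>

lemma prod_decode_Suc:
  "prod_decode (Suc n) =
     (let (a, b) = prod_decode n in if b = 0 then (0, Suc a) else (Suc a, b - 1))"
proof -
  obtain a b where ab: "prod_decode n = (a, b)" by fastforce
  then have n: "n = prod_encode (a, b)" by (metis prod_decode_inverse)
  show ?thesis
  proof (cases b)
    case 0
    then have "Suc n = prod_encode (0, Suc a)" by (simp add: n prod_encode_def)
    then show ?thesis using 0 ab by simp
  next
    case (Suc b')
    then have "Suc n = prod_encode (Suc a, b')" by (simp add: n prod_encode_def)
    then show ?thesis using Suc ab by simp
  qed
qed

lemma prod_decode_0: "prod_decode 0 = (0, 0)"
  by (simp add: prod_decode_def prod_decode_aux.simps)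

lemma exec_unpair_cmd:
  assumes "\<sigma> (k + 1) = 0" "\<sigma> (k + 2) = 0"
  shows "exec C X (unpair_cmd k) \<sigma>
    (\<sigma>(k := 0, k + 1 := fst (prod_decode (\<sigma> k)), k + 2 := snd (prod_decode (\<sigma> k))))"
proof -
  define I where "I i = \<sigma>(k := \<sigma> k - i, k + 1 := fst (prod_decode i), k + 2 := snd (prod_decode i))" for i
  have body: "exec C X (Dec k ;;
     Cond (k + 2) (Dec (k + 2) ;; Inc (k + 1)) (move (k + 1) (k + 2) ;; Inc (k + 2))) (I i) (I (Suc i))" for i
  proof (rule exec.Seq[OF exec.Dec])
    let ?J = "(I i)(k := I i k - 1)"
    show "exec C X (Cond (k + 2) (Dec (k + 2) ;; Inc (k + 1)) (move (k + 1) (k + 2) ;; Inc (k + 2)))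
      ?J (I (Suc i))"
    proof (cases "?J (k + 2) = 0")
      case True
      show ?thesis
        by (rule exec.Cond_false, use True in simp, rule exec_cong, rule exec.Seq, rule exec_move,
            simp, rule exec.Inc)
          (use True in \<open>auto simp: I_def fun_eq_iff prod_decode_Suc split: prod.splits\<close>)
    next
      case False
      show ?thesis
        by (rule exec.Cond_true, use False in simp, rule exec_cong, rule exec.Seq, rule exec.Dec, rule exec.Inc)
          (use False in \<open>auto simp: I_def fun_eq_iff prod_decode_Suc split: prod.splits\<close>)
    qed
  qed
  show ?thesis
    unfolding unpair_cmd_def
    by (rule exec_While[where I = I and n = "\<sigma> k", OF _ body])
      (use assms in \<open>auto simp: I_def prod_decode_0 fun_eq_iff\<close>)
qed

section \<open>Primitive recursive functions\<close>

text \<open>Unary functions suffice: pairing supplies several arguments, and iteration on pairs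
  supplies primitive recursion.\<close>

datatype prim =
    Zero
  | Succ
  | Pred
  | Fst
  | Snd
  | Pair prim prim
  | Comp prim prim
  | Iter prim

abbreviation pi1 :: "nat \<Rightarrow> nat" where "pi1 n \<equiv> fst (prod_decode n)"
abbreviation pi2 :: "nat \<Rightarrow> nat" where "pi2 n \<equiv> snd (prod_decode n)"

fun apply_prim :: "prim \<Rightarrow> nat \<Rightarrow> nat" where
  "apply_prim Zero n = 0"
| "apply_prim Succ n = Suc n"
| "apply_prim Pred n = n - 1"
| "apply_prim Fst n = pi1 n"
| "apply_prim Snd n = pi2 n"
| "apply_prim (Pair f g) n = prod_encode (apply_prim f n, apply_prim g n)"
| "apply_prim (Comp f g) n = apply_prim f (apply_prim g n)"
| "apply_prim (Iter f) n = (apply_prim f ^^ pi1 n) (pi2 n)"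

text \<open>The command replaces the value of register \<open>k\<close>, with the registers above \<open>k\<close> as scratch space.\<close>

fun prim_cmd :: "prim \<Rightarrow> nat \<Rightarrow> cmd" where
  "prim_cmd Zero k = clear k"
| "prim_cmd Succ k = Inc k"
| "prim_cmd Pred k = Dec k"
| "prim_cmd Fst k = unpair_cmd k ;; clear (k + 2) ;; move (k + 1) k"
| "prim_cmd Snd k = unpair_cmd k ;; clear (k + 1) ;; move (k + 2) k"
| "prim_cmd (Pair f g) k =
     move2 k (k + 1) (k + 2) ;; move (k + 2) k ;; prim_cmd f (k + 1) ;;
     move k (k + 2) ;; prim_cmd g (k + 2) ;; pair_cmd k"
| "prim_cmd (Comp f g) k = prim_cmd g k ;; prim_cmd f k"
| "prim_cmd (Iter f) k =
     unpair_cmd k ;; While (k + 1) (prim_cmd f (k + 2) ;; Dec (k + 1)) ;; move (k + 2) k"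

text \<open>Only register \<open>k\<close> changes, so the scratch registers above it are 0 again
  afterwards and the commands can be chained and nested.\<close>

lemma exec_prim_cmd:
  assumes "\<And>j. j > k \<Longrightarrow> \<sigma> j = 0"
  shows "exec C X (prim_cmd f k) \<sigma> (\<sigma>(k := apply_prim f (\<sigma> k)))"
  using assms
proof (induction f arbitrary: k \<sigma>)
  case Zero
  show ?case unfolding prim_cmd.simps apply_prim.simps by (rule exec_clear)
next
  case Succ
  show ?case unfolding prim_cmd.simps apply_prim.simps by (rule exec.Inc)
next
  case Pred
  show ?case unfolding prim_cmd.simps apply_prim.simps by (rule exec.Dec)
next
  case Fst
  show ?case unfolding prim_cmd.simps
    by (rule exec_cong[OF exec.Seq[OF exec_unpair_cmd exec.Seq[OF exec_clear exec_move]]])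
      (auto simp: fun_eq_iff Fst)
next
  case Snd
  show ?case unfolding prim_cmd.simps
    by (rule exec_cong[OF exec.Seq[OF exec_unpair_cmd exec.Seq[OF exec_clear exec_move]]])
      (auto simp: fun_eq_iff Snd)
next
  case (Pair f g)
  let ?a = "apply_prim f (\<sigma> k)" and ?b = "apply_prim g (\<sigma> k)"
  have 1: "exec C X (move2 k (k + 1) (k + 2)) \<sigma> (\<sigma>(k := 0, k + 1 := \<sigma> k, k + 2 := \<sigma> k))"
    by (rule exec_cong[OF exec_move2]) (auto simp: fun_eq_iff Pair.prems)
  have 2: "exec C X (move (k + 2) k) (\<sigma>(k := 0, k + 1 := \<sigma> k, k + 2 := \<sigma> k)) (\<sigma>(k + 1 := \<sigma> k))"
    by (rule exec_cong[OF exec_move]) (auto simp: fun_eq_iff Pair.prems)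
  have 3: "exec C X (prim_cmd f (k + 1)) (\<sigma>(k + 1 := \<sigma> k)) (\<sigma>(k + 1 := ?a))"
    by (rule exec_cong[OF Pair.IH(1)]) (auto simp: fun_eq_iff Pair.prems)
  have 4: "exec C X (move k (k + 2)) (\<sigma>(k + 1 := ?a)) (\<sigma>(k := 0, k + 1 := ?a, k + 2 := \<sigma> k))"
    by (rule exec_cong[OF exec_move]) (auto simp: fun_eq_iff Pair.prems)
  have 5: "exec C X (prim_cmd g (k + 2)) (\<sigma>(k := 0, k + 1 := ?a, k + 2 := \<sigma> k))
      (\<sigma>(k := 0, k + 1 := ?a, k + 2 := ?b))"
    by (rule exec_cong[OF Pair.IH(2)]) (auto simp: fun_eq_iff Pair.prems)
  have 6: "exec C X (pair_cmd k) (\<sigma>(k := 0, k + 1 := ?a, k + 2 := ?b))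
      (\<sigma>(k := apply_prim (Pair f g) (\<sigma> k)))"
    by (rule exec_cong[OF exec_pair_cmd]) (auto simp: fun_eq_iff Pair.prems)
  show ?case unfolding prim_cmd.simps
    by (rule exec.Seq[OF 1 exec.Seq[OF 2 exec.Seq[OF 3 exec.Seq[OF 4 exec.Seq[OF 5 6]]]]])
next
  case (Comp f g)
  show ?case unfolding prim_cmd.simps
    by (rule exec.Seq[OF Comp.IH(2)], simp add: Comp.prems,
        rule exec_cong[OF Comp.IH(1)]) (auto simp: fun_eq_iff Comp.prems)
next
  case (Iter f)
  let ?n = "pi1 (\<sigma> k)" and ?x = "pi2 (\<sigma> k)"
  let ?I = "\<lambda>i. \<sigma>(k := 0, k + 1 := ?n - i, k + 2 := (apply_prim f ^^ i) ?x)"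
  have body: "exec C X (prim_cmd f (k + 2) ;; Dec (k + 1)) (?I i) (?I (Suc i))" for i
    by (rule exec_cong[OF exec.Seq[OF Iter.IH exec.Dec]]) (auto simp: fun_eq_iff Iter.prems)
  have 1: "exec C X (unpair_cmd k) \<sigma> (?I 0)"
    by (rule exec_cong[OF exec_unpair_cmd]) (auto simp: fun_eq_iff Iter.prems)
  have 2: "exec C X (While (k + 1) (prim_cmd f (k + 2) ;; Dec (k + 1))) (?I 0) (?I ?n)"
    by (rule exec_While[where I = ?I and n = ?n, OF _ body]) auto
  have 3: "exec C X (move (k + 2) k) (?I ?n) (\<sigma>(k := apply_prim (Iter f) (\<sigma> k)))"
    by (rule exec_cong[OF exec_move]) (auto simp: fun_eq_iff Iter.prems)
  show ?case unfolding prim_cmd.simps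
    by (rule exec.Seq[OF 1 exec.Seq[OF 2 3]])
qed

section \<open>Query machines\<close>

text \<open>
  A query machine repeatedly applies a primitive recursive function to its state.  The value
  \<open>request k a b c\<close> means: halt with output \<open>a\<close> if \<open>k = 0\<close>, issue the query \<open>Q(a, b)\<close> if \<open>k = 1\<close>,
  ask the oracle about \<open>a\<close> if \<open>k = 2\<close>.  If it does not halt, the next state is the pair of the
  answer (0 if there was no question) and \<open>c\<close>.
\<close>

definition request :: "nat \<Rightarrow> nat \<Rightarrow> nat \<Rightarrow> nat \<Rightarrow> nat" where
  "request k a b c = prod_encode (k, prod_encode (a, prod_encode (b, c)))"

lemma request_inject [simp]:
  "request k a b c = request k' a' b' c' \<longleftrightarrow> k = k' \<and> a = a' \<and> b = b' \<and> c = c'"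
  by (auto simp: request_def)

text \<open>Kind 0 has no rule, and neither has a query outside the domain of \<open>C\<close>:
  these are the halting and the blocked states.\<close>

inductive mstep ::
  "(computation \<times> outcome) set \<Rightarrow> cantor \<Rightarrow> (nat \<Rightarrow> nat) \<Rightarrow> nat \<Rightarrow> nat \<Rightarrow> bool"
  for C :: "(computation \<times> outcome) set" and X :: cantor and F :: "nat \<Rightarrow> nat" where
  conv: "F s = request 1 a b c \<Longrightarrow> ((a, b, X), Converges k) \<in> C \<Longrightarrow> mstep C X F s (prod_encode (1, c))"
| div: "F s = request 1 a b c \<Longrightarrow> ((a, b, X), Diverges) \<in> C \<Longrightarrow> mstep C X F s (prod_encode (0, c))"
| member: "F s = request 2 a b c \<Longrightarrow> mstep C X F s (prod_encode (of_bool (X a), c))"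
| plain: "F s = request k a b c \<Longrightarrow> k > 2 \<Longrightarrow> mstep C X F s (prod_encode (0, c))"

text \<open>Register 0 holds input and output, register 1 the flag that keeps the loop running,
  register 2 the state. Unpacking leaves the four parts of the request in registers 3, 5, 7 and
  8.\<close>

definition decode_cmd :: "prim \<Rightarrow> cmd" where
  "decode_cmd f = prim_cmd f 2 ;; unpair_cmd 2 ;; unpair_cmd 4 ;; unpair_cmd 6"

text \<open>Register 3 changes from the kind of the request to its answer. One decrement isolates
  kind 1, a second one separates kind 2 from the larger kinds.\<close>

definition answer_cmd :: cmd where
  "answer_cmd = Dec 3 ;; Cond 3 (Dec 3 ;; Cond 3 (clear 3) (Member 5 3)) (Query 5 7 3)"

text \<open>\<open>pair_cmd 2\<close> joins registers 3 and 4 into register 2 and needs registers 2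
  and 5 to be 0; clearing register 7 restores the form of \<open>state_store\<close>.\<close>

definition next_cmd :: cmd where
  "next_cmd = clear 5 ;; clear 7 ;; move 8 4 ;; pair_cmd 2"

definition round_cmd :: "prim \<Rightarrow> cmd" where
  "round_cmd f = decode_cmd f ;; Cond 3 (answer_cmd ;; next_cmd) (move 5 0 ;; Dec 1)"

definition start_cmd :: "prim \<Rightarrow> cmd" where
  "start_cmd h = prim_cmd h 0 ;; move 0 2 ;; Inc 1"

definition machine :: "prim \<Rightarrow> prim \<Rightarrow> cmd" where
  "machine h f = start_cmd h ;; While 1 (round_cmd f)"

definition state_store :: "nat \<Rightarrow> store" where
  "state_store s = (\<lambda>_. 0)(1 := 1, 2 := s)"

definition request_store :: "nat \<Rightarrow> nat \<Rightarrow> nat \<Rightarrow> nat \<Rightarrow> store" where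
  "request_store k a b c = (\<lambda>_. 0)(1 := 1, 3 := k, 5 := a, 7 := b, 8 := c)"

lemma exec_decode_cmd:
  assumes "apply_prim f s = request k a b c"
  shows "exec C X (decode_cmd f) (state_store s) (request_store k a b c)"
  unfolding decode_cmd_def
  by (rule exec_cong[OF exec.Seq[OF exec_prim_cmd exec.Seq[OF exec_unpair_cmd
            exec.Seq[OF exec_unpair_cmd exec_unpair_cmd]]]])
    (use assms in \<open>auto simp: fun_eq_iff state_store_def request_store_def request_def\<close>)

lemma exec_next_cmd:
  "exec C X next_cmd (request_store j a b c) (state_store (prod_encode (j, c)))"
  unfolding next_cmd_def
  by (rule exec_cong[OF exec.Seq[OF exec_clear exec.Seq[OF exec_clear
            exec.Seq[OF exec_move exec_pair_cmd]]]])
    (auto simp: fun_eq_iff state_store_def request_store_def)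

lemma exec_answer_cmd_query:
  assumes "exec C X (Query 5 7 3) (request_store 0 a b c) \<sigma>"
  shows "exec C X answer_cmd (request_store 1 a b c) \<sigma>"
proof -
  have "exec C X (Dec 3) (request_store 1 a b c) (request_store 0 a b c)"
    by (rule exec_cong[OF exec.Dec]) (auto simp: request_store_def fun_eq_iff)
  then show ?thesis unfolding answer_cmd_def
    by (rule exec.Seq) (rule exec.Cond_false[OF _ assms], simp add: request_store_def)
qed

lemma exec_answer_cmd_member:
  "exec C X answer_cmd (request_store 2 a b c) (request_store (of_bool (X a)) a b c)"
proof -
  have 1: "exec C X (Dec 3) (request_store 2 a b c) (request_store 1 a b c)"
    by (rule exec_cong[OF exec.Dec]) (auto simp: request_store_def fun_eq_iff)
  have 2: "exec C X (Dec 3) (request_store 1 a b c) (request_store 0 a b c)"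
    by (rule exec_cong[OF exec.Dec]) (auto simp: request_store_def fun_eq_iff)
  have 3: "exec C X (Member 5 3) (request_store 0 a b c) (request_store (of_bool (X a)) a b c)"
    by (rule exec_cong[OF exec.Member]) (auto simp: request_store_def fun_eq_iff)
  have 4: "request_store 1 a b c 3 \<noteq> 0" "request_store 0 a b c 3 = 0"
    by (auto simp: request_store_def fun_eq_iff)
  show ?thesis unfolding answer_cmd_def
    by (rule exec.Seq[OF 1 exec.Cond_true[OF 4(1) exec.Seq[OF 2 exec.Cond_false[OF 4(2) 3]]]])
qed

lemma exec_answer_cmd_plain:
  assumes "k > 2"
  shows "exec C X answer_cmd (request_store k a b c) (request_store 0 a b c)"
proof -
  have 1: "exec C X (Dec 3) (request_store k a b c) (request_store (k - 1) a b c)"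
    by (rule exec_cong[OF exec.Dec]) (auto simp: request_store_def fun_eq_iff)
  have 2: "exec C X (Dec 3) (request_store (k - 1) a b c) (request_store (k - 2) a b c)"
    by (rule exec_cong[OF exec.Dec]) (auto simp: request_store_def fun_eq_iff)
  have 3: "exec C X (clear 3) (request_store (k - 2) a b c) (request_store 0 a b c)"
    by (rule exec_cong[OF exec_clear]) (auto simp: request_store_def fun_eq_iff)
  have 4: "request_store (k - 1) a b c 3 \<noteq> 0" "request_store (k - 2) a b c 3 \<noteq> 0"
    using assms by (auto simp: request_store_def fun_eq_iff)
  show ?thesis unfolding answer_cmd_def
    by (rule exec.Seq[OF 1 exec.Cond_true[OF 4(1) exec.Seq[OF 2 exec.Cond_true[OF 4(2) 3]]]])
qed

lemma exec_round_cmd: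
  assumes "apply_prim f s = request k a b c" "k \<noteq> 0"
    and "exec C X answer_cmd (request_store k a b c) (request_store j a b c)"
  shows "exec C X (round_cmd f) (state_store s) (state_store (prod_encode (j, c)))"
  unfolding round_cmd_def
  by (rule exec.Seq[OF exec_decode_cmd[OF assms(1)] exec.Cond_true[OF _
          exec.Seq[OF assms(3) exec_next_cmd]]])
    (use assms(2) in \<open>simp add: request_store_def\<close>)

lemma exec_round_cmd_mstep:
  assumes "mstep C X (apply_prim f) s s'"
  shows "exec C X (round_cmd f) (state_store s) (state_store s')"
  using assms
proof cases
  case (conv a b c k)
  have "exec C X (Query 5 7 3) (request_store 0 a b c) (request_store 1 a b c)"
    by (rule exec_cong[OF exec.Query_conv[of _ _ _ _ k]])
      (use conv in \<open>auto simp: request_store_def\<close>)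
  then show ?thesis
    unfolding conv by (intro exec_round_cmd[OF conv(2)] exec_answer_cmd_query) auto
next
  case (div a b c)
  have "exec C X (Query 5 7 3) (request_store 0 a b c) (request_store 0 a b c)"
    by (rule exec.Query_div) (use div in \<open>auto simp: request_store_def\<close>)
  then show ?thesis
    unfolding div by (intro exec_round_cmd[OF div(2)] exec_answer_cmd_query) auto
next
  case (member a b c)
  then show ?thesis
    unfolding member(1) by (intro exec_round_cmd[OF member(2)] exec_answer_cmd_member) simp
next
  case (plain k a b c)
  then show ?thesis
    by (auto intro!: exec_round_cmd[OF plain(2)] exec_answer_cmd_plain)
qed

lemma exec_round_cmd_halt:
  assumes "apply_prim f s = request 0 a b c"
  shows "exec C X (round_cmd f) (state_store s) ((request_store 0 0 b c)(0 := a, 1 := 0))"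
  unfolding round_cmd_def
  by (rule exec.Seq[OF exec_decode_cmd[OF assms] exec.Cond_false[OF _
          exec_cong[OF exec.Seq[OF exec_move exec.Dec]]]])
    (auto simp: request_store_def fun_eq_iff)

lemma blocked_round_cmd:
  assumes "apply_prim f s = request 1 a b c" "\<forall>v. ((a, b, X), v) \<notin> C"
  shows "blocked C X (round_cmd f) (state_store s)"
proof -
  have 1: "exec C X (Dec 3) (request_store 1 a b c) (request_store 0 a b c)"
    by (rule exec_cong[OF exec.Dec]) (auto simp: request_store_def fun_eq_iff)
  have "blocked C X (Query 5 7 3) (request_store 0 a b c)"
    by (rule blocked.Query) (use assms(2) in \<open>simp add: request_store_def\<close>)
  then have "blocked C X answer_cmd (request_store 1 a b c)"
    unfolding answer_cmd_def
    by (intro blocked.Seq2[OF 1] blocked.Cond_false) (simp add: request_store_def)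
  then show ?thesis
    unfolding round_cmd_def
    by (intro blocked.Seq2[OF exec_decode_cmd[OF assms(1)]] blocked.Cond_true blocked.Seq1)
      (simp add: request_store_def)
qed

text \<open>The chain need not stay in \<open>S\<close>. It keeps the property that \<open>S\<close>
  can still be reached, so each nonempty path is followed one step at a time.\<close>

lemma infinite_chain:
  assumes "x \<in> S" and closed: "\<And>x. x \<in> S \<Longrightarrow> \<exists>y\<in>S. r\<^sup>+\<^sup>+ x y"
  shows "\<exists>f :: nat \<Rightarrow> 'a. f 0 = x \<and> (\<forall>i. r (f i) (f (Suc i)))"
proof -
  let ?P = "\<lambda>x. \<exists>y\<in>S. r\<^sup>*\<^sup>* x y"
  have "\<exists>y. ?P y \<and> r x y" if x: "?P x" for x
  proof -
    obtain y where y: "y \<in> S" "r\<^sup>*\<^sup>* x y"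
      using x by blast
    moreover obtain z where z: "z \<in> S" "r\<^sup>+\<^sup>+ y z"
      using closed y(1) by blast
    ultimately have "r\<^sup>+\<^sup>+ x z"
      by simp
    then show ?thesis
      using z(1) by (meson tranclpD)
  qed
  then have "\<exists>f. f 0 = x \<and> (\<forall>i. ?P (f i) \<and> r (f i) (f (Suc i)))"
    using dependent_nat_choice[of "\<lambda>i y. ?P y \<and> (i = 0 \<longrightarrow> y = x)" "\<lambda>_. r"] assms(1)
    by (smt (verit) nat.distinct(1) rtranclp.rtrancl_refl)
  then show ?thesis by blast
qed

section \<open>Runs of compiled query machines\<close>

definition computes_machine :: "nat \<Rightarrow> prim \<Rightarrow> prim \<Rightarrow> bool" where
  "computes_machine e h f \<longleftrightarrow> program_of e = compile 0 (machine h f)"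

lemma ex_computes_machine: "\<exists>e. computes_machine e h f"
  unfolding computes_machine_def using surj_program_of by (metis surjD)

locale query_machine =
  fixes e :: nat and h f :: prim
  assumes program: "computes_machine e h f"
begin

abbreviation "P \<equiv> program_of e"

definition loop_pos :: nat where
  "loop_pos = cmd_length (start_cmd h)"

lemma P_eq: "P = compile 0 (start_cmd h) @ compile loop_pos (While 1 (round_cmd f))"
  using program unfolding computes_machine_def machine_def loop_pos_def by simp

lemma code_at_P:
  "code_at P 0 (compile 0 (start_cmd h))"
  "code_at P loop_pos (compile loop_pos (While 1 (round_cmd f)))"
proof -
  have "code_at P 0 (compile 0 (start_cmd h) @ compile loop_pos (While 1 (round_cmd f)))"
    using code_at_self[of P] by (simp only: P_eq)
  then show "code_at P 0 (compile 0 (start_cmd h))"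
    "code_at P loop_pos (compile loop_pos (While 1 (round_cmd f)))"
    unfolding code_at_append length_compile by (simp_all only: loop_pos_def add_0)
qed

lemmas code_at_loop = code_at_P(2)

lemma length_P: "length P = loop_pos + cmd_length (While 1 (round_cmd f))"
  unfolding P_eq length_append length_compile loop_pos_def ..

lemma start_steps:
  "\<exists>T. counters T (state_store (apply_prim h m)) \<and> (step C P X)\<^sup>*\<^sup>* (initial m) (loop_pos, T)"
proof -
  let ?\<sigma> = "(\<lambda>_. 0)(0 := m)"
  have "exec C X (start_cmd h) ?\<sigma> (state_store (apply_prim h m))"
    unfolding start_cmd_def
    by (rule exec_cong[OF exec.Seq[OF exec_prim_cmd exec.Seq[OF exec_move exec.Inc]]])
      (auto simp: fun_eq_iff state_store_def)
  moreover have "counters (snd (initial m)) ?\<sigma>"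
    by (auto simp: counters_def counter_def initial_def)
  ultimately show ?thesis
    using exec_steps[OF _ code_at_P(1)] by (force simp: loop_pos_def initial_def)
qed

lemma mstep_steps:
  assumes "mstep C X (apply_prim f) s s'" "counters T (state_store s)"
  shows "\<exists>T'. counters T' (state_store s') \<and> (step C P X)\<^sup>+\<^sup>+ (loop_pos, T) (loop_pos, T')"
  by (rule while_round_steps[OF _ exec_round_cmd_mstep[OF assms(1)] code_at_loop assms(2)])
    (simp add: state_store_def)

lemma msteps_steps:
  assumes "(mstep C X (apply_prim f))\<^sup>+\<^sup>+ s s'" "counters T (state_store s)"
  shows "\<exists>T'. counters T' (state_store s') \<and> (step C P X)\<^sup>+\<^sup>+ (loop_pos, T) (loop_pos, T')"
  using assms
proof (induction rule: tranclp_induct)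
  case (base s')
  then show ?case by (rule mstep_steps)
next
  case (step s' s'')
  then show ?case using mstep_steps by (meson tranclp_trans)
qed

lemma reachable_steps:
  assumes "(mstep C X (apply_prim f))\<^sup>*\<^sup>* (apply_prim h m) s"
  shows "\<exists>T. counters T (state_store s) \<and> (step C P X)\<^sup>*\<^sup>* (initial m) (loop_pos, T)"
proof -
  obtain T where T: "counters T (state_store (apply_prim h m))"
    "(step C P X)\<^sup>*\<^sup>* (initial m) (loop_pos, T)"
    using start_steps by blast
  from rtranclpD[OF assms] consider "s = apply_prim h m"
    | "(mstep C X (apply_prim f))\<^sup>+\<^sup>+ (apply_prim h m) s"
    by auto
  then show ?thesis
  proof cases
    case 1
    then show ?thesis using T by blast
  next
    case 2
    from msteps_steps[OF this T(1)] T(2) show ?thesis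
      by (meson rtranclp_trans tranclp_into_rtranclp)
  qed
qed

lemma halts_withI:
  assumes "(mstep C X (apply_prim f))\<^sup>*\<^sup>* (apply_prim h m) s" "apply_prim f s = request 0 a b c"
  shows "halts_with C P X m a"
proof -
  obtain T where T: "counters T (state_store s)" "(step C P X)\<^sup>*\<^sup>* (initial m) (loop_pos, T)"
    using reachable_steps[OF assms(1)] by blast
  let ?\<tau> = "(request_store 0 0 b c)(0 := a, 1 := 0)"
  have "exec C X (While 1 (round_cmd f)) (state_store s) ?\<tau>"
    by (rule exec.While_step[OF _ exec_round_cmd_halt[OF assms(2)] exec.While_end])
      (auto simp: state_store_def)
  from exec_steps[OF this code_at_loop T(1)] obtain T' where T': "counters T' ?\<tau>"
    "(step C P X)\<^sup>*\<^sup>* (loop_pos, T) (length P, T')"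
    using length_P by auto
  have "result (length P, T') = a"
    using counters_value[OF T'(1), of 0] by (simp add: result_def)
  then show ?thesis
    using T(2) T'(2) unfolding halts_with_def halted_def
    by (intro exI[of _ "(length P, T')"]) auto
qed

lemma runs_foreverI:
  assumes "(mstep C X (apply_prim f))\<^sup>*\<^sup>* (apply_prim h m) s" "s \<in> S"
    and closed: "\<And>s. s \<in> S \<Longrightarrow> \<exists>s'\<in>S. (mstep C X (apply_prim f))\<^sup>+\<^sup>+ s s'"
  shows "runs_forever C P X m"
proof -
  \<comment> \<open>These are the configurations at the loop head that hold a state of
    \<open>S\<close>. The initial configuration is added to them below.\<close>
  let ?R = "{(loop_pos, T) |T. \<exists>s\<in>S. counters T (state_store s)}"
  obtain T where T: "counters T (state_store s)" "(step C P X)\<^sup>*\<^sup>* (initial m) (loop_pos, T)"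
    using reachable_steps[OF assms(1)] by blast
  have *: "\<exists>d\<in>?R. (step C P X)\<^sup>+\<^sup>+ c d" if "c \<in> ?R" for c
    using that closed msteps_steps by fastforce
  have "\<exists>d\<in>?R. (step C P X)\<^sup>+\<^sup>+ (initial m) d"
    using T assms(2) *[of "(loop_pos, T)"] by (fastforce dest: rtranclp_tranclp_tranclp)
  with * have "\<exists>d\<in>insert (initial m) ?R. (step C P X)\<^sup>+\<^sup>+ c d" if "c \<in> insert (initial m) ?R" for c
    using that by blast
  then show ?thesis
    unfolding runs_forever_def using infinite_chain[of "initial m" "insert (initial m) ?R" "step C P X"]
    by blast
qed

end

text \<open>The answers of \<open>C\<close> and \<open>D\<close> agree, since \<open>C\<close> is
  contained in the single-valued \<open>D\<close>. By determinism the run with \<open>D\<close>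
  cannot leave the run with \<open>C\<close>, which is never stuck.\<close>

lemma run_progress:
  assumes "halts_with C P X m k \<or> runs_forever C P X m" "C \<subseteq> D" "single_valued D"
    and "(step D P X)\<^sup>*\<^sup>* (initial m) c"
  shows "halted P c \<or> (\<exists>c'. step C P X c c')"
proof -
  \<comment> \<open>From a good configuration the run with \<open>C\<close> halts or goes on
    forever. Steps with \<open>D\<close> preserve this.\<close>
  define good where "good c \<longleftrightarrow> (\<exists>c1. (step C P X)\<^sup>*\<^sup>* c c1 \<and> halted P c1) \<or>
    (\<exists>g. g 0 = c \<and> (\<forall>i :: nat. step C P X (g i) (g (Suc i))))" for c
  have det: "c1 = c2" if "step C P X c c1" "step D P X c c2" for c c1 c2
    by (rule step_compatible[OF step_mono[OF that(1) assms(2)] that(2)])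
      (use assms(3) in \<open>auto dest: single_valuedD\<close>)
  from assms(4) have "good c"
  proof induction
    case base
    then show ?case
      using assms(1) by (auto simp: good_def halts_with_def runs_forever_def)
  next
    case (step c c')
    from step.IH show ?case unfolding good_def
    proof (elim disjE exE conjE)
      fix c1 assume c1: "(step C P X)\<^sup>*\<^sup>* c c1" "halted P c1"
      then have "c \<noteq> c1" using step.hyps(2) not_step_halted by blast
      then obtain c2 where "step C P X c c2" "(step C P X)\<^sup>*\<^sup>* c2 c1"
        using c1(1) by (metis converse_rtranclpE)
      then show "(\<exists>c1. (step C P X)\<^sup>*\<^sup>* c' c1 \<and> halted P c1) \<or>
          (\<exists>g. g 0 = c' \<and> (\<forall>i :: nat. step C P X (g i) (g (Suc i))))"
        using det step.hyps(2) c1(2) by blast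
    next
      fix g assume g: "g 0 = c" "\<forall>i :: nat. step C P X (g i) (g (Suc i))"
      then have "g 1 = c'" using det step.hyps(2) by (metis One_nat_def)
      then show "(\<exists>c1. (step C P X)\<^sup>*\<^sup>* c' c1 \<and> halted P c1) \<or>
          (\<exists>g. g 0 = c' \<and> (\<forall>i :: nat. step C P X (g i) (g (Suc i))))"
        using g(2) by (intro disjI2 exI[of _ "\<lambda>i. g (Suc i)"]) auto
    qed
  qed
  then show ?thesis
    unfolding good_def by (metis converse_rtranclpE)
qed

text \<open>At an unanswered query the program would be blocked without having halted, against
  \<open>run_progress\<close>. With \<open>C\<close> an earlier part of the fixed point, this shows
  that the queries of a settled run were settled before it.\<close>

lemma (in query_machine) query_answered:
  assumes "halts_with C P X m k \<or> runs_forever C P X m" "C \<subseteq> feedback"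
    and "(mstep feedback X (apply_prim f))\<^sup>*\<^sup>* (apply_prim h m) s" "apply_prim f s = request 1 a b c"
  shows "\<exists>v. ((a, b, X), v) \<in> C"
proof (rule ccontr)
  assume "\<nexists>v. ((a, b, X), v) \<in> C"
  then have "blocked C X (While 1 (round_cmd f)) (state_store s)"
    by (intro blocked.While blocked_round_cmd[OF assms(4)]) (auto simp: state_store_def)
  moreover obtain T where T: "counters T (state_store s)"
    "(step feedback P X)\<^sup>*\<^sup>* (initial m) (loop_pos, T)"
    using reachable_steps[OF assms(3)] by blast
  ultimately obtain c where c: "(step C P X)\<^sup>*\<^sup>* (loop_pos, T) c" "\<not> halted P c"
      "\<And>c'. \<not> step C P X c c'"
    using blocked_steps[OF _ code_at_loop] by blast
  have "step C P X \<le> step feedback P X"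
    using step_mono assms(2) by blast
  then have "(step feedback P X)\<^sup>*\<^sup>* (initial m) c"
    using T(2) c(1) rtranclp_mono by (metis predicate2D rtranclp_trans)
  then show False
    using run_progress[OF assms(1,2) single_valued_feedback] c(2,3) by blast
qed

section \<open>Closure properties of the primitive recursive functions\<close>

definition prim_rec :: "(nat \<Rightarrow> nat) \<Rightarrow> bool" where
  "prim_rec g \<longleftrightarrow> (\<exists>f. \<forall>n. apply_prim f n = g n)"

definition prim_pred :: "(nat \<Rightarrow> bool) \<Rightarrow> bool" where
  "prim_pred A \<longleftrightarrow> prim_rec (\<lambda>x. of_bool (A x))"

lemma prim_rec_prim: "prim_rec (apply_prim f)"
  by (auto simp: prim_rec_def)

lemma prim_rec_comp: "prim_rec f \<Longrightarrow> prim_rec g \<Longrightarrow> prim_rec (\<lambda>x. f (g x))"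
  unfolding prim_rec_def by (metis apply_prim.simps(7))

lemma prim_rec_id: "prim_rec (\<lambda>x. x)"
  unfolding prim_rec_def by (rule exI[of _ "Pair Fst Snd"]) simp

lemma prim_rec_Suc: "prim_rec f \<Longrightarrow> prim_rec (\<lambda>x. Suc (f x))"
  using prim_rec_comp[OF prim_rec_prim[of Succ]] by simp

lemma prim_rec_const: "prim_rec (\<lambda>x. c)"
proof (induction c)
  case 0
  then show ?case using prim_rec_prim[of Zero] by (simp add: prim_rec_def)
next
  case (Suc c)
  then show ?case by (rule prim_rec_Suc)
qed

lemma prim_rec_pi1: "prim_rec f \<Longrightarrow> prim_rec (\<lambda>x. pi1 (f x))"
  using prim_rec_comp[OF prim_rec_prim[of Fst]] by simp

lemma prim_rec_pi2: "prim_rec f \<Longrightarrow> prim_rec (\<lambda>x. pi2 (f x))"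
  using prim_rec_comp[OF prim_rec_prim[of Snd]] by simp

lemma prim_rec_pair: "prim_rec f \<Longrightarrow> prim_rec g \<Longrightarrow> prim_rec (\<lambda>x. prod_encode (f x, g x))"
  unfolding prim_rec_def by (metis apply_prim.simps(6))

text \<open>\<open>Iter\<close> iterates one fixed unary function, so the parameter \<open>x\<close>
  is carried along unchanged in the first component of a pair.\<close>

lemma prim_rec_funpow:
  assumes "prim_rec (\<lambda>z. g (pi1 z) (pi2 z))" "prim_rec n" "prim_rec a"
  shows "prim_rec (\<lambda>x. (g x ^^ n x) (a x))"
proof -
  obtain h where h: "apply_prim h z = prod_encode (pi1 z, g (pi1 z) (pi2 z))" for z
    using prim_rec_pair[OF prim_rec_pi1[OF prim_rec_id] assms(1)] by (auto simp: prim_rec_def)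
  have pow: "(apply_prim h ^^ i) (prod_encode (x, y)) = prod_encode (x, (g x ^^ i) y)" for i x y
    by (induction i) (simp_all add: h)
  have "prim_rec (\<lambda>x. pi2 (apply_prim (Iter h) (prod_encode (n x, prod_encode (x, a x)))))"
    by (intro prim_rec_pi2 prim_rec_comp[OF prim_rec_prim] prim_rec_pair prim_rec_id assms(2,3))
  then show ?thesis by (simp add: pow)
qed

lemma prim_rec_add:
  assumes "prim_rec f" "prim_rec g"
  shows "prim_rec (\<lambda>x. f x + g x)"
proof -
  have "prim_rec (\<lambda>x. (Suc ^^ f x) (g x))"
    by (intro prim_rec_funpow assms prim_rec_Suc prim_rec_pi2 prim_rec_id)
  moreover have "(Suc ^^ i) j = i + j" for i j
    by (induction i) simp_all
  ultimately show ?thesis by simp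
qed

lemma prim_rec_diff:
  assumes "prim_rec f" "prim_rec g"
  shows "prim_rec (\<lambda>x. f x - g x)"
proof -
  have "prim_rec (\<lambda>x. (apply_prim Pred ^^ g x) (f x))"
    by (intro prim_rec_funpow assms prim_rec_comp[OF prim_rec_prim] prim_rec_pi2 prim_rec_id)
  moreover have "(apply_prim Pred ^^ i) j = j - i" for i j
    by (induction i) simp_all
  ultimately show ?thesis by simp
qed

text \<open>A case distinction is the iteration of a constant map, 0 times or once.\<close>

lemma prim_rec_if:
  assumes "prim_pred A" "prim_rec f" "prim_rec g"
  shows "prim_rec (\<lambda>x. if A x then f x else g x)"
proof -
  have "prim_rec (\<lambda>x. ((\<lambda>_. f x) ^^ of_bool (A x)) (g x))"
    using assms by (intro prim_rec_funpow prim_rec_comp[OF assms(2)] prim_rec_pi1 prim_rec_id)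
      (auto simp: prim_pred_def)
  moreover have "((\<lambda>_. f x) ^^ of_bool (A x)) (g x) = (if A x then f x else g x)" for x
    by simp
  ultimately show ?thesis by simp
qed

lemma prim_pred_eq:
  assumes "prim_rec f" "prim_rec g"
  shows "prim_pred (\<lambda>x. f x = g x)"
proof -
  \<comment> \<open>With truncated subtraction, the sum of the two differences is the distance,
    which is 0 exactly for equal values.\<close>
  have "prim_rec (\<lambda>x. 1 - ((f x - g x) + (g x - f x)))"
    by (intro prim_rec_diff prim_rec_add prim_rec_const assms)
  moreover have "1 - ((f x - g x) + (g x - f x)) = of_bool (f x = g x)" for x
    by auto
  ultimately show ?thesis unfolding prim_pred_def by simp
qed

lemma prim_pred_or:
  assumes "prim_pred A" "prim_pred B"
  shows "prim_pred (\<lambda>x. A x \<or> B x)"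
proof -
  have "prim_rec (\<lambda>x. if A x then 1 else of_bool (B x))"
    using assms by (intro prim_rec_if prim_rec_const) (auto simp: prim_pred_def)
  moreover have "(if A x then 1 else of_bool (B x)) = (of_bool (A x \<or> B x) :: nat)" for x
    by simp
  ultimately show ?thesis unfolding prim_pred_def by (simp only:)
qed

lemmas prim_rec_intros =
  prim_rec_id prim_rec_const prim_rec_Suc prim_rec_pi1 prim_rec_pi2 prim_rec_pair
  prim_rec_add prim_rec_diff prim_rec_if prim_pred_eq prim_pred_or

text \<open>On a pair of quotient and remainder modulo \<open>k\<close>, this is the effect of
  adding 1 to the dividend.\<close>

definition divmod_step :: "nat \<Rightarrow> nat \<Rightarrow> nat" where
  "divmod_step k z =
     (if Suc (pi2 z) = k then prod_encode (Suc (pi1 z), 0) else prod_encode (pi1 z, Suc (pi2 z)))"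

lemma divmod_step_funpow:
  assumes "k > 0"
  shows "(divmod_step k ^^ n) 0 = prod_encode (n div k, n mod k)"
proof (induction n)
  case 0
  then show ?case by (simp add: prod_encode_def)
next
  case (Suc n)
  then show ?case by (simp add: divmod_step_def div_Suc mod_Suc)
qed

lemma prim_rec_divmod:
  assumes "prim_rec f" "k > 0"
  shows "prim_rec (\<lambda>x. f x div k)" "prim_rec (\<lambda>x. f x mod k)"
proof -
  have *: "prim_rec (\<lambda>x. (divmod_step k ^^ f x) 0)"
    unfolding divmod_step_def by (intro prim_rec_funpow prim_rec_intros assms(1))
  show "prim_rec (\<lambda>x. f x div k)" "prim_rec (\<lambda>x. f x mod k)"
    using prim_rec_pi1[OF *] prim_rec_pi2[OF *] by (simp_all add: divmod_step_funpow[OF assms(2)])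
qed

lemma prim_rec_request:
  assumes "prim_rec k" "prim_rec a" "prim_rec b" "prim_rec c"
  shows "prim_rec (\<lambda>x. request (k x) (a x) (b x) (c x))"
  unfolding request_def by (intro prim_rec_pair assms)


section \<open>Arithmetization of programs and tapes\<close>

text \<open>This inverts
  \<open>list_encode (x # xs) = Suc (prod_encode (x, list_encode xs))\<close>; the subtraction
  removes the \<open>Suc\<close>, and 0 codes the empty list.\<close>

definition hd_code :: "nat \<Rightarrow> nat" where
  "hd_code n = pi1 (n - 1)"

definition tl_code :: "nat \<Rightarrow> nat" where
  "tl_code n = pi2 (n - 1)"

lemma hd_code_Suc [simp]: "hd_code (Suc n) = pi1 n"
  by (simp add: hd_code_def)

lemma tl_code_Suc [simp]: "tl_code (Suc n) = pi2 n"
  by (simp add: tl_code_def)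

lemma tl_code_0 [simp]: "tl_code 0 = 0"
  by (simp add: tl_code_def prod_decode_0)

lemma tl_code_less: "n \<noteq> 0 \<Longrightarrow> tl_code n < n"
  by (cases n) (auto simp: less_Suc_eq_le,
      metis le_prod_encode_2 prod_decode_inverse surjective_pairing)

lemma list_decode_tl_code: "list_decode (tl_code n) = tl (list_decode n)"
  by (cases n) (simp_all split: prod.split)

lemma list_decode_tl_code_funpow: "list_decode ((tl_code ^^ q) n) = drop q (list_decode n)"
  by (induction q) (simp_all add: list_decode_tl_code drop_Suc tl_drop)

lemma list_decode_eq_Nil: "list_decode n = [] \<longleftrightarrow> n = 0"
  by (metis list_decode.simps(1) list_decode_inverse)

lemma hd_list_decode: "n \<noteq> 0 \<Longrightarrow> hd (list_decode n) = hd_code n"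
  by (cases n) (simp_all split: prod.split)

text \<open>The number of ones in the binary expansion.\<close>

fun strokes :: "nat \<Rightarrow> nat" where
  "strokes n = (if n = 0 then 0 else n mod 2 + strokes (n div 2))"

declare strokes.simps [simp del]

lemma strokes_rec: "strokes n = n mod 2 + strokes (n div 2)"
  by (cases "n = 0") (simp_all add: strokes.simps)

definition strokes_step :: "nat \<Rightarrow> nat" where
  "strokes_step z = prod_encode (pi1 z div 2, pi2 z + pi1 z mod 2)"

text \<open>Halving \<open>n\<close> reaches 0 within \<open>n\<close> rounds, and later rounds add
  nothing, so \<open>n\<close> itself bounds the iteration.\<close>

lemma strokes_step_funpow:
  "n \<le> j \<Longrightarrow> (strokes_step ^^ j) (prod_encode (n, a)) = prod_encode (0, a + strokes n)"
proof (induction j arbitrary: n a)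
  case 0
  then show ?case by (simp add: strokes.simps)
next
  case (Suc j)
  have "n div 2 \<le> j" using Suc.prems by linarith
  then show ?case
    using Suc.IH[of "n div 2" "a + n mod 2"] strokes_rec[of n]
    by (simp add: funpow_Suc_right strokes_step_def del: funpow.simps)
qed

lemma prim_rec_strokes:
  assumes "prim_rec f"
  shows "prim_rec (\<lambda>x. strokes (f x))"
proof -
  have "prim_rec (\<lambda>x. pi2 ((strokes_step ^^ f x) (prod_encode (f x, 0))))"
    unfolding strokes_step_def
    by (intro prim_rec_funpow prim_rec_divmod prim_rec_intros assms) simp_all
  then show ?thesis by (simp add: strokes_step_funpow)
qed

text \<open>A store of tapes is the list of its updates, the latest first; the store 0 is blank.\<close>

definition lookup_step :: "nat \<Rightarrow> nat \<Rightarrow> nat" where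
  "lookup_step t s = (if s = 0 \<or> pi1 (hd_code s) = t then s else tl_code s)"

definition lookup :: "nat \<Rightarrow> nat \<Rightarrow> nat" where
  "lookup s t = pi2 (hd_code ((lookup_step t ^^ s) s))"

definition update :: "nat \<Rightarrow> nat \<Rightarrow> nat \<Rightarrow> nat" where
  "update s t v = Suc (prod_encode (prod_encode (t, v), s))"

lemma lookup_step_fixed:
  "s = 0 \<or> pi1 (hd_code s) = t \<Longrightarrow> (lookup_step t ^^ j) s = s"
  by (induction j) (auto simp: lookup_step_def)

text \<open>Every unsuccessful search step makes the store code smaller, and the search stands still
  at a hit or at 0. Hence \<open>s\<close> rounds are enough.\<close>

lemma lookup_step_funpow:
  "s \<le> i \<Longrightarrow> i \<le> j \<Longrightarrow> (lookup_step t ^^ j) s = (lookup_step t ^^ i) s"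
proof (induction i arbitrary: j s)
  case 0
  then show ?case by (simp add: lookup_step_fixed)
next
  case (Suc i)
  then obtain j' where j: "j = Suc j'" "i \<le> j'" by (cases j) auto
  show ?case
  proof (cases "s = 0 \<or> pi1 (hd_code s) = t")
    case True
    then show ?thesis by (simp only: lookup_step_fixed)
  next
    case False
    then have "lookup_step t s \<le> i"
      using Suc.prems tl_code_less[of s] by (simp add: lookup_step_def)
    with Suc.IH[OF this j(2)] show ?thesis
      by (simp add: j(1) funpow_Suc_right del: funpow.simps)
  qed
qed

text \<open>The default value 0 is the code of the blank tape, see
  \<open>tape_code_blank\<close>.\<close>

lemma lookup_0: "lookup 0 t = 0"
  by (simp add: lookup_def hd_code_def prod_decode_0)

lemma lookup_update: "lookup (update s t' v) t = (if t = t' then v else lookup s t)"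
proof (cases "t = t'")
  case True
  then show ?thesis
    by (simp add: lookup_def lookup_step_fixed update_def del: funpow.simps)
next
  case False
  let ?n = "prod_encode (prod_encode (t', v), s)"
  have "(lookup_step t ^^ Suc ?n) (Suc ?n) = (lookup_step t ^^ ?n) s"
    using False by (simp add: funpow_Suc_right lookup_step_def del: funpow.simps)
  also have "\<dots> = (lookup_step t ^^ s) s"
    by (rule lookup_step_funpow) (auto simp: le_prod_encode_2)
  finally show ?thesis
    using False by (simp add: lookup_def update_def del: funpow.simps)
qed

lemma prim_rec_hd_code: "prim_rec f \<Longrightarrow> prim_rec (\<lambda>x. hd_code (f x))"
  unfolding hd_code_def by (intro prim_rec_intros)

lemma prim_rec_tl_code: "prim_rec f \<Longrightarrow> prim_rec (\<lambda>x. tl_code (f x))"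
  unfolding tl_code_def by (intro prim_rec_intros)

lemma prim_rec_lookup:
  assumes "prim_rec f" "prim_rec g"
  shows "prim_rec (\<lambda>x. lookup (f x) (g x))"
proof -
  have "prim_rec (\<lambda>x. (lookup_step (g x) ^^ f x) (f x))"
    unfolding lookup_step_def
    by (intro prim_rec_funpow[where g = "\<lambda>x s. if s = 0 \<or> pi1 (hd_code s) = g x then s else tl_code s"]
        prim_rec_intros prim_rec_hd_code prim_rec_tl_code assms prim_rec_comp[OF assms(2)])
  then show ?thesis
    unfolding lookup_def by (intro prim_rec_pi2 prim_rec_hd_code)
qed

lemma prim_rec_update:
  "prim_rec f \<Longrightarrow> prim_rec g \<Longrightarrow> prim_rec h \<Longrightarrow> prim_rec (\<lambda>x. update (f x) (g x) (h x))"
  unfolding update_def by (intro prim_rec_intros)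

text \<open>The first cell is the lowest binary digit. Blanks at the far end do not change the
  number, so listed and unlisted blanks have the same code.\<close>

fun bits :: "bool list \<Rightarrow> nat" where
  "bits [] = 0"
| "bits (b # bs) = of_bool b + 2 * bits bs"

lemma strokes_bits: "strokes (bits bs) = length (filter id bs)"
proof (induction bs)
  case Nil
  then show ?case by (simp add: strokes.simps)
next
  case (Cons b bs)
  show ?case
    using Cons strokes_rec[of "bits (b # bs)"] by (cases b) simp_all
qed

definition tape_code :: "tape \<Rightarrow> nat" where
  "tape_code T = prod_encode (bits (fst T), bits (snd T))"

definition strokes_code :: "nat \<Rightarrow> nat" where
  "strokes_code z = strokes (pi1 z) + strokes (pi2 z)"

text \<open>The cases follow the numbering in \<open>action_decode\<close>. The scanned cell is the
  lowest digit of the second component, so a move shifts one digit from one number to the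
  other.\<close>

definition perform_code :: "nat \<Rightarrow> nat \<Rightarrow> nat" where
  "perform_code k z =
     (if k = 0 then prod_encode (pi1 z, pi2 z div 2 + pi2 z div 2)
      else if k = 1 then prod_encode (pi1 z, Suc (pi2 z div 2 + pi2 z div 2))
      else if k = 2 then prod_encode (pi1 z div 2, pi1 z mod 2 + (pi2 z + pi2 z))
      else prod_encode (pi2 z mod 2 + (pi1 z + pi1 z), pi2 z div 2))"

lemma tape_code_blank: "tape_code ([], []) = 0"
  by (simp add: tape_code_def prod_encode_def)

lemma tape_value_code: "tape_value T = strokes_code (tape_code T)"
  by (simp add: tape_value_def tape_code_def strokes_code_def strokes_bits)

lemma scanned_code: "scanned T \<longleftrightarrow> pi2 (tape_code T) mod 2 = 1"
  by (cases T rule: scanned.cases) (simp_all add: tape_code_def)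

lemma bits_div_2: "bits bs div 2 = bits (tl bs)"
  by (cases bs) auto

lemma tape_code_perform:
  "tape_code (perform (fst (action_decode n)) T) = perform_code (n mod 4) (tape_code T)"
proof -
  have "n mod 4 < 4" by simp
  then consider "n mod 4 = 0" | "n mod 4 = 1" | "n mod 4 = 2" | "n mod 4 = 3" by linarith
  then show ?thesis
  proof cases
    case 1
    then show ?thesis
      by (cases T) (simp add: action_decode_def perform_code_def tape_code_def bits_div_2)
  next
    case 2
    then show ?thesis
      by (cases T) (simp add: action_decode_def perform_code_def tape_code_def bits_div_2)
  next
    case 3
    then show ?thesis
      by (cases "(Move_Left, T)" rule: perform.cases)
        (simp_all add: action_decode_def perform_code_def tape_code_def)
  next
    case 4
    then show ?thesis
      by (cases "(Move_Right, T)" rule: perform.cases)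
        (simp_all add: action_decode_def perform_code_def tape_code_def)
  qed
qed

lemma prim_rec_strokes_code: "prim_rec f \<Longrightarrow> prim_rec (\<lambda>x. strokes_code (f x))"
  unfolding strokes_code_def by (intro prim_rec_intros prim_rec_strokes)

lemma prim_rec_perform_code:
  "prim_rec f \<Longrightarrow> prim_rec g \<Longrightarrow> prim_rec (\<lambda>x. perform_code (f x) (g x))"
  unfolding perform_code_def by (intro prim_rec_intros prim_rec_divmod) simp_all

section \<open>The comparison and selection machine\<close>

text \<open>A simulation consists of the index \<open>f\<close> of the machine itself, the simulated
  program \<open>e\<close>, the other computation \<open>y\<close>, the position \<open>q\<close>
  and the tape store \<open>s\<close>.\<close>

definition sim_data :: "nat \<Rightarrow> nat \<Rightarrow> nat \<Rightarrow> nat \<Rightarrow> nat \<Rightarrow> nat" where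
  "sim_data f e y q s = prod_encode (f, prod_encode (e, prod_encode (y, prod_encode (q, s))))"

definition sim_self :: "nat \<Rightarrow> nat" where "sim_self d = pi1 d"
definition sim_prog :: "nat \<Rightarrow> nat" where "sim_prog d = pi1 (pi2 d)"
definition sim_other :: "nat \<Rightarrow> nat" where "sim_other d = pi1 (pi2 (pi2 d))"
definition sim_pos :: "nat \<Rightarrow> nat" where "sim_pos d = pi1 (pi2 (pi2 (pi2 d)))"
definition sim_tapes :: "nat \<Rightarrow> nat" where "sim_tapes d = pi2 (pi2 (pi2 (pi2 d)))"

lemma sim_data_sel [simp]:
  "sim_self (sim_data f e y q s) = f" "sim_prog (sim_data f e y q s) = e"
  "sim_other (sim_data f e y q s) = y" "sim_pos (sim_data f e y q s) = q"
  "sim_tapes (sim_data f e y q s) = s"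
  by (simp_all add: sim_data_def sim_self_def sim_prog_def sim_other_def sim_pos_def sim_tapes_def)

definition sim_goto :: "nat \<Rightarrow> nat \<Rightarrow> nat \<Rightarrow> nat" where
  "sim_goto d q s = sim_data (sim_self d) (sim_prog d) (sim_other d) q s"

text \<open>The code of the instructions from the current position on; it is 0 exactly when the
  simulated run has halted.\<close>

definition sim_rest :: "nat \<Rightarrow> nat" where
  "sim_rest d = (tl_code ^^ sim_pos d) (sim_prog d)"

definition sim_instr :: "nat \<Rightarrow> nat" where "sim_instr d = hd_code (sim_rest d)"
text \<open>The operands as in \<open>instr_decode\<close>; for a \<open>Feedback\<close>
  instruction \<open>sim_arg3\<close> is still the pair of both targets.\<close>

definition sim_arg1 :: "nat \<Rightarrow> nat" where "sim_arg1 d = pi1 (sim_instr d div 3)"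
definition sim_arg2 :: "nat \<Rightarrow> nat" where "sim_arg2 d = pi1 (pi2 (sim_instr d div 3))"
definition sim_arg3 :: "nat \<Rightarrow> nat" where "sim_arg3 d = pi2 (pi2 (sim_instr d div 3))"

definition sim_tape :: "nat \<Rightarrow> nat \<Rightarrow> nat" where "sim_tape d t = lookup (sim_tapes d) t"
definition sim_value :: "nat \<Rightarrow> nat \<Rightarrow> nat" where "sim_value d t = strokes_code (sim_tape d t)"

definition sim_action :: "nat \<Rightarrow> nat" where
  "sim_action d = (if pi2 (sim_tape d (sim_arg1 d)) mod 2 = 1 then sim_arg3 d else sim_arg2 d)"

definition sim_act :: "nat \<Rightarrow> nat" where
  "sim_act d = sim_goto d (sim_action d div 4) (update (sim_tapes d) (sim_arg1 d)
     (perform_code (sim_action d mod 4) (sim_tape d (sim_arg1 d))))"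

text \<open>
  The states of the machine are pairs of an answer and \<open>state r d\<close>, where \<open>r\<close> is the mode.
  Computations are coded as pairs of an index and an input.  Every input contains the index \<open>f\<close>
  of the machine itself.
\<close>

definition state :: "nat \<Rightarrow> nat \<Rightarrow> nat" where
  "state r d = prod_encode (r, d)"

definition compare_input :: "nat \<Rightarrow> nat \<Rightarrow> nat \<Rightarrow> nat" where
  "compare_input f x y = state 0 (prod_encode (f, prod_encode (x, y)))"

text \<open>After the end of the simulated run the state repeats itself forever. A simulated query
  is not issued at once: first \<open>y\<close> is compared with it, so the roles are swapped at
  each level.\<close>

definition sim_request :: "nat \<Rightarrow> nat" where
  "sim_request d =
     (if sim_rest d = 0 then request 3 0 0 (state 1 d)
      else if sim_instr d mod 3 = 0 then request 3 0 0 (state 1 (sim_act d))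
      else if sim_instr d mod 3 = 1 then request 2 (sim_value d (sim_arg1 d)) 0 (state 2 d)
      else request 1 (sim_self d) (compare_input (sim_self d) (sim_other d)
        (prod_encode (sim_value d (sim_arg1 d), sim_value d (sim_arg2 d)))) (state 3 d))"

text \<open>The number with \<open>m\<close> binary digits 1, which codes \<open>m\<close>
  strokes.\<close>

definition input_tape_code :: "nat \<Rightarrow> nat" where
  "input_tape_code m = ((\<lambda>n. Suc (n + n)) ^^ m) 0"

definition sim_start :: "nat \<Rightarrow> nat" where
  "sim_start d = sim_data (pi1 d) (pi1 (pi1 (pi2 d))) (pi2 (pi2 d)) 0
     (update 0 0 (prod_encode (0, input_tape_code (pi2 (pi1 (pi2 d))))))"

definition search_data :: "nat \<Rightarrow> nat \<Rightarrow> nat \<Rightarrow> nat \<Rightarrow> nat" where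
  "search_data f e l n = prod_encode (f, prod_encode (e, prod_encode (l, n)))"

definition search_self :: "nat \<Rightarrow> nat" where "search_self d = pi1 d"
definition search_prog :: "nat \<Rightarrow> nat" where "search_prog d = pi1 (pi2 d)"
definition search_args :: "nat \<Rightarrow> nat" where "search_args d = pi1 (pi2 (pi2 d))"
definition search_num :: "nat \<Rightarrow> nat" where "search_num d = pi2 (pi2 (pi2 d))"

lemma search_data_sel [simp]:
  "search_self (search_data f e l n) = f" "search_prog (search_data f e l n) = e"
  "search_args (search_data f e l n) = l" "search_num (search_data f e l n) = n"
  by (simp_all add: search_data_def search_self_def search_prog_def search_args_def search_num_def)

definition search_next :: "nat \<Rightarrow> nat" where
  "search_next d = search_data (search_self d) (search_prog d) (search_args d) (Suc (search_num d))"

text \<open>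
  Modes 0 to 4 compare two computations (0: set up the simulation, 1: simulate one instruction,
  2: answer of the oracle, 3: answer of the inner comparison, 4: answer of the simulated query),
  modes 5 to 7 are the search \<open>Y\<close> (7: output), and modes 8 and 9 are \<open>B\<close>, which freezes by querying
  itself.
\<close>

definition transition :: "nat \<Rightarrow> nat" where
  "transition s =
     (let b = pi1 s; r = pi1 (pi2 s); d = pi2 (pi2 s) in
      if r = 0 then request 3 0 0 (state 1 (sim_start d))
      else if r = 1 then sim_request d
      else if r = 2 then
        request 3 0 0 (state 1 (sim_goto d (if b = 0 then sim_arg2 d else sim_arg3 d) (sim_tapes d)))
      else if r = 3 then
        (if b = 0 then request 0 0 0 0
         else request 1 (sim_value d (sim_arg1 d)) (sim_value d (sim_arg2 d)) (state 4 d))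
      else if r = 4 then
        request 3 0 0 (state 1 (sim_goto d
          (if b = 0 then pi2 (sim_arg3 d) else pi1 (sim_arg3 d)) (sim_tapes d)))
      else if r = 5 then
        request 1 (search_self d) (compare_input (search_self d)
          (prod_encode (search_self d, state 8 d))
          (prod_encode (search_self d, state 5 (search_next d)))) (state 6 d)
      else if r = 6 then
        (if b = 0 then request 1 (search_self d) (state 8 d) (state 7 d)
         else request 1 (search_self d) (state 5 (search_next d)) (state 5 (search_next d)))
      else if r = 7 then request 0 (search_num d) 0 0
      else if r = 8 then
        request 1 (search_prog d) (Suc (prod_encode (search_num d, search_args d))) (state 9 d)
      else if b = 0 then request 1 (search_self d) (state 8 d) 0
      else request 0 0 0 0)"

lemma prim_rec_state: "prim_rec f \<Longrightarrow> prim_rec g \<Longrightarrow> prim_rec (\<lambda>x. state (f x) (g x))"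
  unfolding state_def by (intro prim_rec_intros)

lemma prim_rec_tl_code_funpow:
  assumes "prim_rec f" "prim_rec g"
  shows "prim_rec (\<lambda>x. (tl_code ^^ f x) (g x))"
  by (intro prim_rec_funpow assms prim_rec_tl_code prim_rec_pi2 prim_rec_id)

lemma prim_rec_input_tape_code:
  assumes "prim_rec f"
  shows "prim_rec (\<lambda>x. input_tape_code (f x))"
  unfolding input_tape_code_def by (intro prim_rec_funpow prim_rec_intros assms)

lemma prim_rec_transition: "prim_rec transition"
  unfolding transition_def Let_def sim_start_def sim_request_def sim_act_def sim_action_def
    sim_value_def sim_tape_def sim_goto_def sim_data_def search_next_def search_data_def
    compare_input_def sim_arg1_def sim_arg2_def sim_arg3_def sim_instr_def sim_rest_def
    sim_self_def sim_prog_def sim_other_def sim_pos_def sim_tapes_def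
    search_self_def search_prog_def search_args_def search_num_def
  by (intro prim_rec_if prim_pred_eq prim_rec_request prim_rec_state prim_rec_perform_code
      prim_rec_update prim_rec_lookup prim_rec_strokes_code prim_rec_hd_code
      prim_rec_tl_code_funpow prim_rec_input_tape_code prim_rec_divmod prim_rec_intros) simp_all

section \<open>Correctness of the simulation\<close>

abbreviation mstate :: "nat \<Rightarrow> nat \<Rightarrow> nat \<Rightarrow> nat" where
  "mstate b r d \<equiv> prod_encode (b, state r d)"

lemma transition_simps [simp]:
  "transition (mstate b 0 d) = request 3 0 0 (state 1 (sim_start d))"
  "transition (mstate b (Suc 0) d) = sim_request d"
  "transition (mstate b 2 d) =
     request 3 0 0 (state 1 (sim_goto d (if b = 0 then sim_arg2 d else sim_arg3 d) (sim_tapes d)))"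
  "transition (mstate 0 3 d) = request 0 0 0 0"
  "transition (mstate (Suc 0) 3 d) =
     request 1 (sim_value d (sim_arg1 d)) (sim_value d (sim_arg2 d)) (state 4 d)"
  "transition (mstate b 4 d) = request 3 0 0 (state 1 (sim_goto d
     (if b = 0 then pi2 (sim_arg3 d) else pi1 (sim_arg3 d)) (sim_tapes d)))"
  "transition (mstate b 5 d) =
     request 1 (search_self d) (compare_input (search_self d)
       (prod_encode (search_self d, state 8 d))
       (prod_encode (search_self d, state 5 (search_next d)))) (state 6 d)"
  "transition (mstate 0 6 d) = request 1 (search_self d) (state 8 d) (state 7 d)"
  "transition (mstate (Suc 0) 6 d) =
     request 1 (search_self d) (state 5 (search_next d)) (state 5 (search_next d))"
  "transition (mstate b 7 d) = request 0 (search_num d) 0 0"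
  "transition (mstate b 8 d) =
     request 1 (search_prog d) (Suc (prod_encode (search_num d, search_args d))) (state 9 d)"
  "transition (mstate 0 9 d) = request 1 (search_self d) (state 8 d) 0"
  "transition (mstate (Suc 0) 9 d) = request 0 0 0 0"
  by (simp_all add: transition_def state_def)

text \<open>Only lookups are compared: a store keeps outdated entries, so the tapes do not determine
  it.\<close>

definition simulates :: "nat \<Rightarrow> nat \<Rightarrow> nat \<Rightarrow> nat \<Rightarrow> config \<Rightarrow> bool" where
  "simulates d f e y c \<longleftrightarrow>
     (\<exists>s. d = sim_data f e y (fst c) s \<and> (\<forall>t. lookup s t = tape_code (snd c t)))"

lemma bits_input: "bits (replicate m True) = input_tape_code m"
  unfolding input_tape_code_def by (induction m) simp_all

lemma simulates_start:
  "simulates (sim_start (prod_encode (f, prod_encode (prod_encode (e, m), y)))) f e y (initial m)"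
  unfolding simulates_def
  by (rule exI[of _ "update 0 0 (prod_encode (0, input_tape_code m))"])
    (simp add: sim_start_def initial_def lookup_update lookup_0 tape_code_def
      bits_input tape_code_blank[unfolded tape_code_def, simplified])

lemma program_of_sim:
  assumes "simulates d f e y (q, T)"
  shows "q < length (program_of e) \<longleftrightarrow> sim_rest d \<noteq> 0"
    and "q < length (program_of e) \<Longrightarrow> program_of e ! q = instr_decode (sim_instr d)"
proof -
  have *: "list_decode (sim_rest d) = drop q (list_decode e)"
    using assms by (auto simp: simulates_def sim_rest_def list_decode_tl_code_funpow)
  then show iff: "q < length (program_of e) \<longleftrightarrow> sim_rest d \<noteq> 0"
    by (metis drop_eq_Nil2 length_map linorder_not_less list_decode_eq_Nil program_of_def)
  assume q: "q < length (program_of e)"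
  then have "list_decode e ! q = sim_instr d"
    using iff * by (metis hd_drop_conv_nth hd_list_decode length_map program_of_def sim_instr_def)
  with q show "program_of e ! q = instr_decode (sim_instr d)"
    by (simp add: program_of_def)
qed

lemma sim_value_eq: "simulates d f e y (q, T) \<Longrightarrow> sim_value d t = tape_value (T t)"
  by (auto simp: simulates_def sim_value_def sim_tape_def tape_value_code)

lemma simulates_goto:
  "simulates d f e y (q, T) \<Longrightarrow> simulates (sim_goto d q' (sim_tapes d)) f e y (q', T)"
  by (auto simp: simulates_def sim_goto_def)

lemma sim_halted:
  assumes "simulates d f e y c" "halted (program_of e) c"
  shows "sim_request d = request 3 0 0 (state 1 d)"
  using assms program_of_sim(1)[of d f e y "fst c" "snd c"]
  by (simp add: sim_request_def halted_def)

lemma instr_decode_cases: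
  "instr_decode n =
     (if n mod 3 = 0 then Act (pi1 (n div 3))
        (action_decode (pi1 (pi2 (n div 3)))) (action_decode (pi2 (pi2 (n div 3))))
      else if n mod 3 = 1 then Ask (pi1 (n div 3)) (pi1 (pi2 (n div 3))) (pi2 (pi2 (n div 3)))
      else Feedback (pi1 (n div 3)) (pi1 (pi2 (n div 3)))
        (pi1 (pi2 (pi2 (n div 3)))) (pi2 (pi2 (pi2 (n div 3)))))"
  by (simp add: instr_decode_def Let_def split: prod.split)

lemma sim_instr_cases:
  assumes "simulates d f e y (q, T)" "q < length (program_of e)"
  shows "program_of e ! q =
    (if sim_instr d mod 3 = 0 then Act (sim_arg1 d) (action_decode (sim_arg2 d)) (action_decode (sim_arg3 d))
     else if sim_instr d mod 3 = 1 then Ask (sim_arg1 d) (sim_arg2 d) (sim_arg3 d)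
     else Feedback (sim_arg1 d) (sim_arg2 d) (pi1 (sim_arg3 d)) (pi2 (sim_arg3 d)))"
  using program_of_sim(2)[OF assms] instr_decode_cases[of "sim_instr d"]
  by (simp add: sim_arg1_def sim_arg2_def sim_arg3_def)

lemma simulates_act:
  assumes "simulates d f e y (q, T)" "t = sim_arg1 d"
    and "(a, q') = action_decode (if scanned (T t) then sim_arg3 d else sim_arg2 d)"
  shows "simulates (sim_act d) f e y (q', T(t := perform a (T t)))"
proof -
  have "lookup (sim_tapes d) t = tape_code (T t)" for t
    using assms(1) by (auto simp: simulates_def)
  moreover from this have "sim_action d = (if scanned (T t) then sim_arg3 d else sim_arg2 d)"
    by (simp add: sim_action_def sim_tape_def scanned_code assms(2))
  moreover from this have "a = fst (action_decode (sim_action d))" "q' = sim_action d div 4"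
    using assms(3) by (metis fst_conv, metis snd_conv action_decode_def)
  ultimately show ?thesis
    using assms(1,2)
    by (auto simp: simulates_def sim_act_def sim_goto_def sim_tape_def lookup_update tape_code_perform)
qed

lemma mstep_plain:
  "F s = request 3 a b c \<Longrightarrow> mstep C X F s (prod_encode (0, c))"
  by (rule mstep.plain) auto

text \<open>Steps other than feedback queries depend on \<open>X\<close> only, so the answers
  \<open>C\<close> of the simulated run and \<open>D\<close> of the machine may differ.\<close>

lemma sim_step:
  assumes "simulates d f e y c" "step C (program_of e) X c c'"
    and "\<And>t u qc qd. program_of e ! fst c \<noteq> Feedback t u qc qd"
  shows "\<exists>d'. simulates d' f e y c' \<and> (mstep D X transition)\<^sup>+\<^sup>+ (mstate 0 1 d) (mstate 0 1 d')"
  using assms(2)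
proof cases
  case (act q t d0 d1 a q' T)
  note d = assms(1)[unfolded act(1)]
  have i: "sim_instr d mod 3 = 0" "t = sim_arg1 d" "d0 = action_decode (sim_arg2 d)"
    "d1 = action_decode (sim_arg3 d)"
    using sim_instr_cases[OF d act(3)] act(4) by (auto split: if_splits)
  have "simulates (sim_act d) f e y c'"
    unfolding act(2) by (rule simulates_act[OF d i(2)]) (use act i in auto)
  moreover have "mstep D X transition (mstate 0 1 d) (mstate 0 1 (sim_act d))"
    by (rule mstep_plain) (use program_of_sim(1)[OF d] act(3) i in \<open>simp add: sim_request_def\<close>)
  ultimately show ?thesis by blast
next
  case (ask q t q0 q1 q' T)
  note d = assms(1)[unfolded ask(1)]
  have i: "sim_instr d mod 3 = 1" "t = sim_arg1 d" "q0 = sim_arg2 d" "q1 = sim_arg3 d"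
    using sim_instr_cases[OF d ask(3)] ask(4) by (auto split: if_splits)
  let ?d' = "sim_goto d q' (sim_tapes d)" and ?b = "of_bool (X (tape_value (T t)))"
  have "mstep D X transition (mstate 0 1 d) (mstate ?b 2 d)"
    by (rule mstep.member[where b = 0])
      (use program_of_sim(1)[OF d] ask(3) i in \<open>simp add: sim_request_def sim_value_eq[OF d]\<close>)
  moreover have "mstep D X transition (mstate ?b 2 d) (mstate 0 1 ?d')"
    by (rule mstep_plain) (use ask(5) i in simp)
  ultimately show ?thesis
    using simulates_goto[OF d, of q'] unfolding ask(2) by (meson tranclp.intros)
next
  case (feedback_conv q t u qc qd T k)
  then show ?thesis using assms(3)[of t u qc qd] by simp
next
  case (feedback_div q t u qc qd T)
  then show ?thesis using assms(3)[of t u qc qd] by simp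
qed

text \<open>The stages of one simulated query: the inner comparison, the query itself, and the
  continuation after each of the two answers.\<close>

lemma sim_feedback:
  assumes "simulates d f e y (q, T)" "q < length (program_of e)"
    and "program_of e ! q = Feedback t u qc qd"
  shows "sim_request d = request 1 f
      (compare_input f y (prod_encode (tape_value (T t), tape_value (T u)))) (state 3 d)"
    and "transition (mstate 1 3 d) = request 1 (tape_value (T t)) (tape_value (T u)) (state 4 d)"
    and "\<exists>d'. simulates d' f e y (qc, T) \<and> transition (mstate 1 4 d) = request 3 0 0 (state 1 d')"
    and "\<exists>d'. simulates d' f e y (qd, T) \<and> transition (mstate 0 4 d) = request 3 0 0 (state 1 d')"
proof -
  have "sim_instr d mod 3 \<noteq> 0" "sim_instr d mod 3 \<noteq> 1" "t = sim_arg1 d" "u = sim_arg2 d"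
    "qc = pi1 (sim_arg3 d)" "qd = pi2 (sim_arg3 d)"
    using sim_instr_cases[OF assms(1,2)] assms(3) by (auto split: if_splits)
  moreover have "sim_self d = f" "sim_other d = y"
    using assms(1) by (auto simp: simulates_def)
  ultimately show "sim_request d = request 1 f
      (compare_input f y (prod_encode (tape_value (T t), tape_value (T u)))) (state 3 d)"
    "transition (mstate 1 3 d) = request 1 (tape_value (T t)) (tape_value (T u)) (state 4 d)"
    "\<exists>d'. simulates d' f e y (qc, T) \<and> transition (mstate 1 4 d) = request 3 0 0 (state 1 d')"
    "\<exists>d'. simulates d' f e y (qd, T) \<and> transition (mstate 0 4 d) = request 3 0 0 (state 1 d')"
    using program_of_sim(1)[OF assms(1)] assms(2) simulates_goto[OF assms(1)]
    by (auto simp: sim_request_def sim_value_eq[OF assms(1)])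
qed

section \<open>Unfolding and induction for the fixed point\<close>

lemma Converges_in_feedback_iff:
  "((e, m, X), Converges k) \<in> feedback \<longleftrightarrow> halts_with feedback (program_of e) X m k"
proof -
  have "((e, m, X), Converges k) \<in> feedback_op feedback \<longleftrightarrow>
      halts_with feedback (program_of e) X m k"
    unfolding feedback_op_def by blast
  then show ?thesis by (simp flip: feedback_unfold)
qed

lemma Diverges_in_feedback_iff:
  "((e, m, X), Diverges) \<in> feedback \<longleftrightarrow> runs_forever feedback (program_of e) X m"
proof -
  have "((e, m, X), Diverges) \<in> feedback_op feedback \<longleftrightarrow>
      runs_forever feedback (program_of e) X m"
    unfolding feedback_op_def by blast
  then show ?thesis by (simp flip: feedback_unfold)
qed

lemmas feedback_unfold_iff = Converges_in_feedback_iff Diverges_in_feedback_iff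

text \<open>Induction on the rank, without ordinals: \<open>C\<close> stands for the computations
  settled earlier, and the run of the computation in question needs only the answers in
  \<open>C\<close>.\<close>

lemma feedback_induct [consumes 1, case_names run]:
  assumes "((e, m, X), v) \<in> feedback"
    and step: "\<And>C e m X. C \<subseteq> feedback \<Longrightarrow> (\<And>e m X v. ((e, m, X), v) \<in> C \<Longrightarrow> Q e m X) \<Longrightarrow>
      (\<exists>k. halts_with C (program_of e) X m k) \<or> runs_forever C (program_of e) X m \<Longrightarrow> Q e m X"
  shows "Q e m X"
proof -
  let ?S = "{((e, m, X), v) |e m X v. Q e m X}"
  have "feedback_op (feedback \<inter> ?S) \<subseteq> ?S"
  proof
    fix z assume z: "z \<in> feedback_op (feedback \<inter> ?S)"
    then obtain e m X v where zv: "z = ((e, m, X), v)"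
      and run: "(\<exists>k. halts_with (feedback \<inter> ?S) (program_of e) X m k) \<or>
        runs_forever (feedback \<inter> ?S) (program_of e) X m"
      unfolding feedback_op_def by blast
    have "Q e m X"
      by (rule step[OF _ _ run]) blast+
    then show "z \<in> ?S" unfolding zv by blast
  qed
  then have "feedback \<subseteq> ?S"
    unfolding feedback_def by (rule lfp_induct[OF mono_feedback_op])
  with assms(1) show ?thesis by blast
qed

text \<open>The analogue of \<open>query_answered\<close> for arbitrary programs, needed for the
  computations that are being simulated.\<close>

lemma queries_answered:
  assumes "(\<exists>k. halts_with C P X m k) \<or> runs_forever C P X m" "C \<subseteq> feedback"
    and "(step feedback P X)\<^sup>*\<^sup>* (initial m) (q, T)" "q < length P" "P ! q = Feedback t u qc qd"
  shows "\<exists>v. ((tape_value (T t), tape_value (T u), X), v) \<in> C"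
proof -
  obtain c' where "step C P X (q, T) c'"
    using assms(1,4) run_progress[OF _ assms(2) single_valued_feedback assms(3)]
    unfolding halted_def by (metis fst_conv linorder_not_less)
  then show ?thesis
    by cases (use assms(5) in auto)
qed

section \<open>Settled computations and their comparison\<close>

definition settled :: "cantor \<Rightarrow> nat \<Rightarrow> bool" where
  "settled X x \<longleftrightarrow> (\<exists>v. ((pi1 x, pi2 x, X), v) \<in> feedback)"

lemma settled_pair: "settled X (prod_encode (e, m)) \<longleftrightarrow> (\<exists>v. ((e, m, X), v) \<in> feedback)"
  by (simp add: settled_def)

lemma mstep_query:
  assumes "F s = request 1 a b c" "((a, b, X), v) \<in> C"
  shows "\<exists>i. mstep C X F s (prod_encode (i, c))"
  using assms(2) mstep.conv[where F = F, OF assms(1)] mstep.div[where F = F, OF assms(1)]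
  by (cases v) blast+

text \<open>\<open>Pair Fst Snd\<close> is the identity, so the start function only puts the answer
  0 in front: an input of machine \<open>f\<close> is already a mode with its data.\<close>

locale selection = query_machine f "Pair Zero (Pair Fst Snd)" F for f :: nat and F :: prim +
  assumes F: "apply_prim F = transition"
begin

lemma convergesI:
  assumes "(mstep feedback X transition)\<^sup>*\<^sup>* (prod_encode (0, m)) s" "transition s = request 0 a b c"
  shows "((f, m, X), Converges a) \<in> feedback"
  unfolding feedback_unfold_iff using halts_withI[of feedback X m s a b c] assms by (simp add: F)

lemma divergesI:
  assumes "(mstep feedback X transition)\<^sup>*\<^sup>* (prod_encode (0, m)) s" "s \<in> S"
    and "\<And>s. s \<in> S \<Longrightarrow> \<exists>s'\<in>S. (mstep feedback X transition)\<^sup>+\<^sup>+ s s'"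
  shows "((f, m, X), Diverges) \<in> feedback"
  unfolding feedback_unfold_iff using runs_foreverI[of feedback X m s S] assms by (simp add: F)

lemma machine_query_answered:
  assumes "(\<exists>k. halts_with C P X m k) \<or> runs_forever C P X m" "C \<subseteq> feedback"
    and "(mstep feedback X transition)\<^sup>*\<^sup>* (prod_encode (0, m)) s" "transition s = request 1 a b c"
  shows "\<exists>v. ((a, b, X), v) \<in> C"
  using query_answered[of C X m _ s a b c] assms by (auto simp: F)

definition compare_converges :: "cantor \<Rightarrow> nat \<Rightarrow> nat \<Rightarrow> bool" where
  "compare_converges X x y \<longleftrightarrow> (\<exists>k. ((f, compare_input f x y, X), Converges k) \<in> feedback)"

definition compare_diverges :: "cantor \<Rightarrow> nat \<Rightarrow> nat \<Rightarrow> bool" where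
  "compare_diverges X x y \<longleftrightarrow> ((f, compare_input f x y, X), Diverges) \<in> feedback"

definition compare_sound :: "cantor \<Rightarrow> nat \<Rightarrow> nat \<Rightarrow> bool" where
  "compare_sound X x y \<longleftrightarrow>
     compare_converges X x y \<and> settled X y \<or> compare_diverges X x y \<and> settled X x"

text \<open>\<open>A\<close> is what becomes known when an inner comparison stops the simulation; it
  will be instantiated with \<open>y\<close> being settled. If nothing stops it, the simulation
  follows the whole run of program \<open>e\<close> and shows that this run never freezes.\<close>

lemma compare_run:
  assumes queries: "\<And>q T t u qc qd. (step feedback (program_of e) X)\<^sup>*\<^sup>* (initial m) (q, T) \<Longrightarrow>
      q < length (program_of e) \<Longrightarrow> program_of e ! q = Feedback t u qc qd \<Longrightarrow>
      compare_converges X y (prod_encode (tape_value (T t), tape_value (T u))) \<and>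
        settled X (prod_encode (tape_value (T t), tape_value (T u))) \<or>
      compare_diverges X y (prod_encode (tape_value (T t), tape_value (T u))) \<and> A"
  shows "compare_converges X (prod_encode (e, m)) y \<and> A \<or>
    compare_diverges X (prod_encode (e, m)) y \<and> settled X (prod_encode (e, m))"
proof -
  let ?step = "step feedback (program_of e) X" and ?mstep = "mstep feedback X transition"
  let ?s0 = "prod_encode (0, compare_input f (prod_encode (e, m)) y)"
  define halts where "halts s \<longleftrightarrow> (\<exists>s' a b c. ?mstep\<^sup>*\<^sup>* s s' \<and> transition s' = request 0 a b c)" for s
  \<comment> \<open>Divergence of the inner comparison makes the machine halt and yields
    \<open>A\<close>; convergence guarantees that the simulated query is settled.\<close>
  have feedback_case: "halts (mstate 0 1 d) \<and> A \<or>
      settled X (prod_encode (tape_value (T t), tape_value (T u))) \<and> ?mstep (mstate 0 1 d) (mstate 1 3 d)"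
    if "?step\<^sup>*\<^sup>* (initial m) (q, T)" "simulates d f e y (q, T)" "q < length (program_of e)"
      "program_of e ! q = Feedback t u qc qd" for d q T t u qc qd
  proof -
    let ?x = "prod_encode (tape_value (T t), tape_value (T u))"
    have tr: "transition (mstate 0 1 d) = request 1 f (compare_input f y ?x) (state 3 d)"
      using sim_feedback(1)[OF that(2-4)] by simp
    from queries[OF that(1,3,4)] show ?thesis
    proof
      assume "compare_converges X y ?x \<and> settled X ?x"
      then show ?thesis
        using mstep.conv[where F = transition, OF tr] by (auto simp: compare_converges_def)
    next
      assume "compare_diverges X y ?x \<and> A"
      moreover from this have "?mstep (mstate 0 1 d) (mstate 0 3 d)"
        using mstep.div[where F = transition, OF tr] by (auto simp: compare_diverges_def)
      then have "halts (mstate 0 1 d)"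
        unfolding halts_def by (intro exI[of _ "mstate 0 3 d"] exI[of _ 0]) auto
      ultimately show ?thesis by blast
    qed
  qed
  have simulated_step: "halts (mstate 0 1 d) \<and> A \<or>
      (\<exists>d'. simulates d' f e y c' \<and> ?mstep\<^sup>+\<^sup>+ (mstate 0 1 d) (mstate 0 1 d'))"
    if "?step\<^sup>*\<^sup>* (initial m) c" "simulates d f e y c" "?step c c'" for c c' d
  proof (cases "\<exists>t u qc qd. program_of e ! fst c = Feedback t u qc qd")
    case False
    then show ?thesis using sim_step[OF that(2,3)] by blast
  next
    case True
    obtain q T where c: "c = (q, T)" by fastforce
    with True obtain t u qc qd where i: "program_of e ! q = Feedback t u qc qd" by auto
    have q: "q < length (program_of e)"
      using that(3) not_step_halted unfolding halted_def c by (metis fst_conv linorder_not_less)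
    note sim = sim_feedback[OF that(2)[unfolded c] q i]
    have "?mstep (mstate 0 1 d) (mstate 1 3 d) \<Longrightarrow>
        \<exists>d'. simulates d' f e y c' \<and> ?mstep\<^sup>+\<^sup>+ (mstate 0 1 d) (mstate 0 1 d')"
    proof -
      assume 1: "?mstep (mstate 0 1 d) (mstate 1 3 d)"
      have "\<exists>j d'. ?mstep (mstate 1 3 d) (mstate j 4 d) \<and> ?mstep (mstate j 4 d) (mstate 0 1 d') \<and>
          simulates d' f e y c'"
        using that(3)
      proof cases
        case (feedback_conv q' t' u' qc' qd' T' k)
        then have "?mstep (mstate 1 3 d) (mstate 1 4 d)"
          using mstep.conv[where F = transition, OF sim(2)] i c by auto
        moreover obtain d' where "simulates d' f e y (qc, T)"
          "transition (mstate 1 4 d) = request 3 0 0 (state 1 d')"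
          using sim(3) by blast
        ultimately show ?thesis
          using feedback_conv i c mstep_plain[of transition "mstate 1 4 d"]
          by (intro exI[of _ 1] exI[of _ d']) auto
      next
        case (feedback_div q' t' u' qc' qd' T')
        then have "?mstep (mstate 1 3 d) (mstate 0 4 d)"
          using mstep.div[where F = transition, OF sim(2)] i c by auto
        moreover obtain d' where "simulates d' f e y (qd, T)"
          "transition (mstate 0 4 d) = request 3 0 0 (state 1 d')"
          using sim(4) by blast
        ultimately show ?thesis
          using feedback_div i c mstep_plain[of transition "mstate 0 4 d"]
          by (intro exI[of _ 0] exI[of _ d']) auto
      qed (use i c in auto)
      then show ?thesis
        using 1 by (meson tranclp.intros)
    qed
    then show ?thesis
      using feedback_case[OF that(1,2)[unfolded c] q i] by blast
  qed
  have progress: "halts (mstate 0 1 d) \<and> A \<or> (\<exists>c'. ?step c c')"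
    if "?step\<^sup>*\<^sup>* (initial m) c" "simulates d f e y c" "\<not> halted (program_of e) c" for c d
  proof -
    obtain q T where c: "c = (q, T)" by fastforce
    with that(3) have q: "q < length (program_of e)" by (simp add: halted_def)
    show ?thesis
    proof (cases "program_of e ! q")
      case (Act t d0 d1)
      then show ?thesis using step_Act[OF q Act refl] c by blast
    next
      case (Ask t q0 q1)
      then show ?thesis using step.ask[OF q Ask refl] c by blast
    next
      case (Feedback t u qc qd)
      have "settled X (prod_encode (tape_value (T t), tape_value (T u))) \<Longrightarrow> \<exists>c'. ?step c c'"
        using step.feedback_conv[OF q Feedback] step.feedback_div[OF q Feedback] c
        by (metis outcome.exhaust settled_pair)
      then show ?thesis
        using feedback_case[OF that(1,2)[unfolded c] q Feedback] by blast
    qed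
  qed
  \<comment> \<open>Unless it halts with \<open>A\<close>, the simulation arrives at every
    configuration reachable by program \<open>e\<close>.\<close>
  have reach: "halts ?s0 \<and> A \<or> (\<exists>d. simulates d f e y c \<and> ?mstep\<^sup>*\<^sup>* ?s0 (mstate 0 1 d))"
    if "?step\<^sup>*\<^sup>* (initial m) c" for c
    using that
  proof induction
    case base
    let ?d = "sim_start (prod_encode (f, prod_encode (prod_encode (e, m), y)))"
    have "?mstep ?s0 (mstate 0 1 ?d)"
      by (rule mstep_plain) (simp add: compare_input_def)
    then show ?case using simulates_start by blast
  next
    case (step c c')
    from step.IH show ?case
    proof
      assume "\<exists>d. simulates d f e y c \<and> ?mstep\<^sup>*\<^sup>* ?s0 (mstate 0 1 d)"
      then obtain d where d: "simulates d f e y c" "?mstep\<^sup>*\<^sup>* ?s0 (mstate 0 1 d)" by blast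
      from simulated_step[OF step.hyps(1) d(1) step.hyps(2)] d(2) show ?case
        unfolding halts_def by (meson rtranclp_trans tranclp_into_rtranclp)
    qed blast
  qed
  show ?thesis
  proof (cases "halts ?s0 \<and> A")
    case True
    then have "compare_converges X (prod_encode (e, m)) y"
      unfolding halts_def compare_converges_def using convergesI by blast
    with True show ?thesis by blast
  next
    case False
    have halts_trans: "halts s \<Longrightarrow> ?mstep\<^sup>*\<^sup>* ?s0 s \<Longrightarrow> halts ?s0" for s
      unfolding halts_def by (meson rtranclp_trans)
    let ?R = "{c. ?step\<^sup>*\<^sup>* (initial m) c}"
    \<comment> \<open>The simulated run cannot get stuck, since any query it reaches has passed its
      inner comparison and is therefore settled.\<close>
    have next_step: "\<exists>c'. ?step c c'" if "c \<in> ?R" "\<not> halted (program_of e) c" for c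
      using progress[of c] reach[of c] False halts_trans that by blast
    have "settled X (prod_encode (e, m))"
    proof (cases "\<exists>c\<in>?R. halted (program_of e) c")
      case True
      then have "\<exists>k. halts_with feedback (program_of e) X m k"
        by (auto simp: halts_with_def)
      then show ?thesis by (auto simp: settled_pair simp flip: feedback_unfold_iff)
    next
      case False
      with next_step have "\<exists>c'\<in>?R. ?step\<^sup>+\<^sup>+ c c'" if "c \<in> ?R" for c
        using that by (metis mem_Collect_eq rtranclp.rtrancl_into_rtrancl tranclp.r_into_trancl)
      then have "runs_forever feedback (program_of e) X m"
        unfolding runs_forever_def using infinite_chain[of "initial m" ?R ?step] by blast
      then show ?thesis by (auto simp: settled_pair simp flip: feedback_unfold_iff)
    qed
    moreover have "compare_diverges X (prod_encode (e, m)) y"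
    proof -
      \<comment> \<open>The simulation states reached are closed under nonempty runs; once the
        simulated run has halted, its state is its own successor.\<close>
      let ?S = "{mstate 0 1 d |d. \<exists>c\<in>?R. simulates d f e y c \<and> ?mstep\<^sup>*\<^sup>* ?s0 (mstate 0 1 d)}"
      obtain d where d: "simulates d f e y (initial m)" "?mstep\<^sup>*\<^sup>* ?s0 (mstate 0 1 d)"
        using reach[of "initial m"] False by blast
      then have "mstate 0 1 d \<in> ?S" by blast
      moreover have "\<exists>s'\<in>?S. ?mstep\<^sup>+\<^sup>+ s s'" if s_in: "s \<in> ?S" for s
      proof -
        obtain d c where s: "s = mstate 0 1 d" and c: "c \<in> ?R" "simulates d f e y c"
          "?mstep\<^sup>*\<^sup>* ?s0 (mstate 0 1 d)"
          using s_in by blast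
        show ?thesis
        proof (cases "halted (program_of e) c")
          case True
          have "?mstep s s"
            unfolding s by (rule mstep_plain) (simp add: sim_halted[OF c(2) True])
          then show ?thesis using s_in by blast
        next
          case halted: False
          then obtain c' where c': "?step c c'" using next_step c(1) by blast
          have "\<not> (halts (mstate 0 1 d) \<and> A)"
            using False halts_trans c(3) by blast
          then obtain d' where d': "simulates d' f e y c'" "?mstep\<^sup>+\<^sup>+ (mstate 0 1 d) (mstate 0 1 d')"
            using simulated_step[OF _ c(2) c'] c(1) by blast
          moreover have "c' \<in> ?R" using c(1) c' by auto
          moreover have "?mstep\<^sup>*\<^sup>* ?s0 (mstate 0 1 d')"
            using c(3) d'(2) by (meson rtranclp_trans tranclp_into_rtranclp)
          ultimately show ?thesis unfolding s by blast
        qed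
      qed
      ultimately show ?thesis
        unfolding compare_diverges_def by (intro divergesI[OF d(2)])
    qed
    ultimately show ?thesis by blast
  qed
qed

text \<open>Both orders are needed in one induction on the rank of \<open>(e, m)\<close>: comparing
  it with \<open>y\<close> asks to compare \<open>y\<close> with queries of \<open>(e, m)\<close>,
  and there the second half of the induction hypothesis applies.\<close>

lemma compare_sound_settled:
  assumes "((e, m, X), v) \<in> feedback"
  shows "\<forall>y. compare_sound X (prod_encode (e, m)) y \<and> compare_sound X y (prod_encode (e, m))"
  using assms
proof (induction rule: feedback_induct)
  case (run C e m X)
  have answered: "\<exists>v. ((tape_value (T t), tape_value (T u), X), v) \<in> C"
    if "(step feedback (program_of e) X)\<^sup>*\<^sup>* (initial m) (q, T)" "q < length (program_of e)"
      "program_of e ! q = Feedback t u qc qd" for q T t u qc qd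
    using queries_answered[OF run.hyps(2,1) that] .
  have "feedback_op C \<subseteq> feedback"
    using mono_feedback_op run.hyps(1) feedback_unfold by (metis monoD)
  moreover have "\<exists>v. ((e, m, X), v) \<in> feedback_op C"
    using run.hyps(2) unfolding feedback_op_def by blast
  ultimately have x: "settled X (prod_encode (e, m))"
    unfolding settled_pair by blast
  have left: "compare_sound X (prod_encode (e, m)) y" for y
    unfolding compare_sound_def
  proof (rule compare_run)
    fix q T t u qc qd
    assume "(step feedback (program_of e) X)\<^sup>*\<^sup>* (initial m) (q, T)" "q < length (program_of e)"
      "program_of e ! q = Feedback t u qc qd"
    from answered[OF this] run.IH show "compare_converges X y (prod_encode (tape_value (T t), tape_value (T u))) \<and>
        settled X (prod_encode (tape_value (T t), tape_value (T u))) \<or>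
      compare_diverges X y (prod_encode (tape_value (T t), tape_value (T u))) \<and> settled X y"
      unfolding compare_sound_def by blast
  qed
  \<comment> \<open>Here \<open>y\<close> may freeze, and its queries need not be settled. But the
    inner comparisons now have \<open>(e, m)\<close> on the left, so the half just proved covers all
    of them.\<close>
  have "compare_sound X y (prod_encode (e, m))" for y
  proof -
    obtain e' m' where y: "y = prod_encode (e', m')"
      by (metis prod_decode_inverse surj_pair)
    show ?thesis
      unfolding compare_sound_def y
      by (rule compare_run) (use left x in \<open>auto simp: compare_sound_def\<close>)
  qed
  with left show ?case by blast
qed

lemma compare_sound:
  assumes "settled X x \<or> settled X y"
  shows "compare_sound X x y"
  using assms compare_sound_settled unfolding settled_def
  by (metis prod_decode_inverse surjective_pairing)

section \<open>The check \<open>B n\<close> and the search \<open>Y n\<close>\<close>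

lemma check_settled_imp:
  assumes "((f, state 8 (search_data f e l n), X), v) \<in> feedback"
  shows "feedback_defined e X (Suc (prod_encode (n, l)))"
proof -
  have "f' = f \<longrightarrow> m' = state 8 (search_data f e l n) \<longrightarrow> feedback_defined e X (Suc (prod_encode (n, l)))"
    if "((f', m', X), v) \<in> feedback" for f' m'
    using that
  proof (induction rule: feedback_induct)
    case (run C f' m' X)
    show ?case
    proof (intro impI)
      assume f': "f' = f" and m': "m' = state 8 (search_data f e l n)"
      let ?d = "search_data f e l n"
      note answered = machine_query_answered[OF run.hyps(2)[unfolded f' m'] run.hyps(1)]
      have tr: "transition (mstate 0 8 ?d) = request 1 e (Suc (prod_encode (n, l))) (state 9 ?d)"
        by simp
      obtain w where w: "((e, Suc (prod_encode (n, l)), X), w) \<in> C"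
        using answered[OF _ tr] by blast
      show "feedback_defined e X (Suc (prod_encode (n, l)))"
      proof (cases w)
        case (Converges k)
        then show ?thesis
          using w run.hyps(1) by (auto simp: feedback_defined_def feedback_conv_def)
      next
        case Diverges
        then have "mstep feedback X transition (mstate 0 8 ?d) (mstate 0 9 ?d)"
          using mstep.div[where F = transition, OF tr] w run.hyps(1) by auto
        \<comment> \<open>After the answer "diverges" the check queries itself. A settled run would
          have this query settled earlier, so the induction hypothesis applies.\<close>
        then have "\<exists>w. ((f, state 8 ?d, X), w) \<in> C"
          by (intro answered[where s = "mstate 0 9 ?d" and c = 0]) auto
        then show ?thesis using run.IH by blast
      qed
    qed
  qed
  with assms show ?thesis by blast
qed

lemma check_settled:
  assumes "feedback_defined e X (Suc (prod_encode (n, l)))"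
  shows "settled X (prod_encode (f, state 8 (search_data f e l n)))"
proof -
  let ?d = "search_data f e l n"
  have tr: "transition (mstate 0 8 ?d) = request 1 e (Suc (prod_encode (n, l))) (state 9 ?d)"
    by simp
  have "mstep feedback X transition (mstate 0 8 ?d) (mstate 1 9 ?d)"
    using assms mstep.conv[where F = transition, OF tr] by (auto simp: feedback_defined_def feedback_conv_def)
  then have "((f, state 8 ?d, X), Converges 0) \<in> feedback"
    by (intro convergesI[where s = "mstate 1 9 ?d"]) auto
  then show ?thesis by (auto simp: settled_pair)
qed

text \<open>This speaks of machine states rather than of the index \<open>f\<close>, so it also
  serves the selecting machine, which has another index and start function.\<close>

definition search_halts :: "cantor \<Rightarrow> nat \<Rightarrow> nat \<Rightarrow> nat \<Rightarrow> bool" where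
  "search_halts X e l s \<longleftrightarrow> (\<exists>s' k. (mstep feedback X transition)\<^sup>*\<^sup>* s s' \<and>
     transition s' = request 0 k 0 0 \<and> feedback_defined e X (Suc (prod_encode (k, l))))"

lemma search_halts_step:
  "mstep feedback X transition s s' \<Longrightarrow> search_halts X e l s' \<Longrightarrow> search_halts X e l s"
  unfolding search_halts_def by (meson converse_rtranclp_into_rtranclp)

lemma search_halts_found:
  assumes "settled X (prod_encode (f, state 8 (search_data f e l n)))"
  shows "search_halts X e l (mstate 0 6 (search_data f e l n))"
proof -
  let ?d = "search_data f e l n"
  obtain v where v: "((f, state 8 ?d, X), v) \<in> feedback"
    using assms by (auto simp: settled_pair)
  have "transition (mstate 0 6 ?d) = request 1 f (state 8 ?d) (state 7 ?d)"
    by simp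
  then obtain i where "mstep feedback X transition (mstate 0 6 ?d) (mstate i 7 ?d)"
    using mstep_query v by blast
  moreover have "search_halts X e l (mstate i 7 ?d)"
    unfolding search_halts_def
    by (intro exI[of _ "mstate i 7 ?d"] exI[of _ n]) (simp add: check_settled_imp[OF v])
  ultimately show ?thesis by (rule search_halts_step)
qed

lemma search_halts_next:
  assumes "((f, state 5 (search_data f e l (Suc n)), X), v) \<in> feedback"
    and "\<And>i. search_halts X e l (mstate i 5 (search_data f e l (Suc n)))"
  shows "search_halts X e l (mstate 1 6 (search_data f e l n))"
proof -
  let ?d = "search_data f e l n" and ?d' = "search_data f e l (Suc n)"
  have "transition (mstate 1 6 ?d) = request 1 f (state 5 ?d') (state 5 ?d')"
    by (simp add: search_next_def)
  then show ?thesis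
    using mstep_query assms by (blast intro: search_halts_step)
qed

lemma transition_search:
  "transition (mstate i 5 (search_data f e l n)) = request 1 f
     (compare_input f (prod_encode (f, state 8 (search_data f e l n)))
       (prod_encode (f, state 5 (search_data f e l (Suc n))))) (state 6 (search_data f e l n))"
  by (simp add: search_next_def)

text \<open>Induction on the rank: a run of \<open>Y n\<close> has queried either
  \<open>B n\<close>, which certifies the output \<open>n\<close>, or \<open>Y (n + 1)\<close>, to
  which the induction hypothesis applies.\<close>

lemma search_settled_imp:
  assumes "((f, state 5 (search_data f e l n), X), v) \<in> feedback"
  shows "search_halts X e l (mstate i 5 (search_data f e l n))"
proof -
  \<comment> \<open>The candidate \<open>n\<close> grows along the search, and \<open>i\<close> is
    arbitrary because mode 5 is re-entered with the answer to the query of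
    \<open>Y (n + 1)\<close>.\<close>
  have "\<forall>n i. f' = f \<longrightarrow> m' = state 5 (search_data f e l n) \<longrightarrow>
      search_halts X e l (mstate i 5 (search_data f e l n))"
    if "((f', m', X), v) \<in> feedback" for f' m'
    using that
  proof (induction rule: feedback_induct)
    case (run C f' m' X)
    show ?case
    proof (intro allI impI)
      fix n i assume f': "f' = f" and m': "m' = state 5 (search_data f e l n)"
      let ?d = "search_data f e l n" and ?d' = "search_data f e l (Suc n)"
      note answered = machine_query_answered[OF run.hyps(2)[unfolded f' m'] run.hyps(1)]
      obtain w where w: "((f, compare_input f (prod_encode (f, state 8 ?d))
          (prod_encode (f, state 5 ?d')), X), w) \<in> C"
        using answered[OF _ transition_search[of 0]] by blast
      show "search_halts X e l (mstate i 5 ?d)"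
      proof (cases w)
        case (Converges k)
        then have st: "mstep feedback X transition (mstate j 5 ?d) (mstate 1 6 ?d)" for j
          using mstep.conv[where F = transition, OF transition_search[of j]] w run.hyps(1) by auto
        then obtain w' where "((f, state 5 ?d', X), w') \<in> C"
          using answered[where s = "mstate 1 6 ?d" and c = "state 5 ?d'"]
          by (auto simp: search_next_def)
        then have "search_halts X e l (mstate 1 6 ?d)"
          using run.hyps(1) run.IH by (intro search_halts_next) blast+
        with st show ?thesis by (rule search_halts_step)
      next
        case Diverges
        then have st: "mstep feedback X transition (mstate j 5 ?d) (mstate 0 6 ?d)" for j
          using mstep.div[where F = transition, OF transition_search[of j]] w run.hyps(1) by auto
        \<comment> \<open>Mode 6 queries \<open>B n\<close> before the output, which makes
          \<open>B n\<close> one of the earlier settled computations.\<close>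
        then have "\<exists>w. ((f, state 8 ?d, X), w) \<in> C"
          by (intro answered[where s = "mstate 0 6 ?d" and c = "state 7 ?d"]) auto
        then have "search_halts X e l (mstate 0 6 ?d)"
          using \<open>C \<subseteq> feedback\<close> by (intro search_halts_found) (auto simp: settled_pair)
        with st show ?thesis by (rule search_halts_step)
      qed
    qed
  qed
  with assms show ?thesis by blast
qed

text \<open>One settled side makes the comparison sound, and its outcome then sends the search to a
  side that is settled.\<close>

lemma search_settled_Suc:
  assumes "settled X (prod_encode (f, state 8 (search_data f e l n))) \<or>
    settled X (prod_encode (f, state 5 (search_data f e l (Suc n))))"
  shows "settled X (prod_encode (f, state 5 (search_data f e l n)))"
proof -
  let ?d = "search_data f e l n" and ?d' = "search_data f e l (Suc n)"
  have "search_halts X e l (mstate 0 5 ?d)"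
    using compare_sound[OF assms] unfolding compare_sound_def
  proof (elim disjE conjE)
    assume "compare_converges X (prod_encode (f, state 8 ?d)) (prod_encode (f, state 5 ?d'))"
    then have "mstep feedback X transition (mstate 0 5 ?d) (mstate 1 6 ?d)"
      using mstep.conv[where F = transition, OF transition_search[of 0]] by (auto simp: compare_converges_def)
    moreover assume "settled X (prod_encode (f, state 5 ?d'))"
    then have "search_halts X e l (mstate 1 6 ?d)"
      using search_halts_next search_settled_imp by (auto simp: settled_pair)
    ultimately show ?thesis by (rule search_halts_step)
  next
    assume "compare_diverges X (prod_encode (f, state 8 ?d)) (prod_encode (f, state 5 ?d'))"
    then have "mstep feedback X transition (mstate 0 5 ?d) (mstate 0 6 ?d)"
      using mstep.div[where F = transition, OF transition_search[of 0]] by (auto simp: compare_diverges_def)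
    moreover assume "settled X (prod_encode (f, state 8 ?d))"
    then have "search_halts X e l (mstate 0 6 ?d)"
      by (rule search_halts_found)
    ultimately show ?thesis by (rule search_halts_step)
  qed
  then show ?thesis
    using convergesI by (fastforce simp: search_halts_def settled_pair)
qed

lemma search_settled_0:
  assumes "feedback_defined e X (Suc (prod_encode (n, l)))"
  shows "settled X (prod_encode (f, state 5 (search_data f e l 0)))"
proof -
  have "settled X (prod_encode (f, state 5 (search_data f e l n)))"
    using check_settled[OF assms] by (intro search_settled_Suc) simp
  \<comment> \<open>The induction runs downward from \<open>n\<close> to 0: a settled
    \<open>Y (j + 1)\<close> settles \<open>Y j\<close>.\<close>
  then show ?thesis
    by (induction n) (auto intro: search_settled_Suc)
qed

end

section \<open>The selection function\<close>

theorem theorem2p30: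
  shows "\<exists>Sel :: cantor \<Rightarrow> nat \<times> nat list \<rightharpoonup> nat.
    (\<forall>X. partial_feedback_computable X tuple_code (Sel X) \<and>
         (\<forall>e ms. (\<exists>p. feedback_defined e X (tuple_code (p, ms))) \<longleftrightarrow>
                 (\<exists>p. Sel X (e, ms) = Some p \<and> feedback_defined e X (tuple_code (p, ms))))) \<and>
    (\<exists>s. \<forall>X. feedback_computes s X tuple_code (Sel X))"
proof -
  obtain F where F: "apply_prim F = transition"
    using prim_rec_transition by (auto simp: prim_rec_def)
  obtain f where f: "computes_machine f (Pair Zero (Pair Fst Snd)) F"
    using ex_computes_machine by blast
  interpret selection f F
    by unfold_locales (use F f in auto)
  \<comment> \<open>The selecting machine has the transitions of machine \<open>f\<close> but starts
    as \<open>Y 0\<close>: it splits its input into \<open>e\<close> and the code of the arguments,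
    and inserts the constant \<open>f\<close> for the queries.\<close>
  have "prim_rec (\<lambda>m. prod_encode (0, state 5 (search_data f (hd_code m) (tl_code m) 0)))"
    unfolding search_data_def by (intro prim_rec_intros prim_rec_state prim_rec_hd_code prim_rec_tl_code)
  then obtain h where h: "\<And>m. apply_prim h m =
      prod_encode (0, state 5 (search_data f (hd_code m) (tl_code m) 0))"
    by (auto simp: prim_rec_def)
  obtain s where s: "computes_machine s h F"
    using ex_computes_machine by blast
  then interpret sel: query_machine s h F
    by unfold_locales
  \<comment> \<open>The partial function with index \<open>s\<close>;
    \<open>feedback_conv_unique\<close> makes the description meaningful.\<close>
  define Sel where "Sel X x = (if \<exists>k. feedback_conv s X (tuple_code x) k
    then Some (THE k. feedback_conv s X (tuple_code x) k) else None)" for X x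
  have Sel: "Sel X x = Some k \<longleftrightarrow> feedback_conv s X (tuple_code x) k" for X x k
    unfolding Sel_def using feedback_conv_unique by (auto intro: theI2 the_equality)
  have computes: "feedback_computes s X tuple_code (Sel X)" for X
    by (simp add: feedback_computes_def Sel)
  have code: "tuple_code (p, ms) = Suc (prod_encode (p, list_encode ms))" for p ms
    by (simp add: tuple_code_def)
  have "\<exists>p. Sel X (e, ms) = Some p \<and> feedback_defined e X (tuple_code (p, ms))"
    if "feedback_defined e X (tuple_code (p, ms))" for e X p ms
  proof -
    have "settled X (prod_encode (f, state 5 (search_data f e (list_encode ms) 0)))"
      using that search_settled_0 unfolding code by blast
    then have "search_halts X e (list_encode ms) (mstate 0 5 (search_data f e (list_encode ms) 0))"
      using search_settled_imp by (auto simp: settled_pair)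
    then obtain s' k where k: "(mstep feedback X transition)\<^sup>*\<^sup>* (apply_prim h (tuple_code (e, ms))) s'"
      "transition s' = request 0 k 0 0" "feedback_defined e X (tuple_code (k, ms))"
      unfolding search_halts_def code h by auto
    \<comment> \<open>The halting search is a sequence of \<open>transition\<close> steps, which
      machine \<open>s\<close> performs literally, with the same output \<open>k\<close>.\<close>
    have "feedback_conv s X (tuple_code (e, ms)) k"
      unfolding feedback_conv_def feedback_unfold_iff
      using sel.halts_withI[of feedback X _ s' k 0 0] k by (simp add: F)
    with k(3) show ?thesis by (auto simp: Sel)
  qed
  then show ?thesis
    using computes unfolding partial_feedback_computable_def by (intro exI[of _ Sel]) blast
qed

end
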